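(* For every Markoff number $m$, the number $\dfrac{2m}{\sqrt{9m^2-4}+3m}$ is a limit point of $\mathcal{Z}\cap(\tfrac13,\infty)$. Conversely, every limit point of $\mathcal{Z}$ that is larger than $\tfrac13$ is of the form $\dfrac{2m}{\sqrt{9m^2-4}+3m}$ for some Markoff number $m$.
   Context: For a rational number $a/b$ in lowest terms with $b\ge 2$, set $\mathcal{Z}(a/b)=\min_{q\in\mathbb{N},\,0<q<b} q\,\|qa/b\|$, where $\|x\|$ denotes the distance from $x$ to the nearest integer. The $\mathcal{Z}$-spectrum is the set $\mathcal{Z}=\{\mathcal{Z}(a/b): a/b\in\mathbb{Q}\}$; equivalently it is the set of values $\inf_{(x,y)\in\Lambda,\,xy\neq0}|xy|$ as $\Lambda$ ranges over unimodular lattices of $\mathbb{R}^2$ contained in $\sqrt{d}\,\mathbb{Q}^2$ for some positive rational $d$. A Markoff number is a positive integer that occurs as a coordinate of a positive integer solution of $x^2+y^2+z^2=3xyz$. *)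

theory Defs
  imports "HOL-Analysis.Analysis"
begin

definition dist_int :: "real \<Rightarrow> real" where
  "dist_int x = \<bar>x - of_int (round x)\<bar>"

definition Zval :: "rat \<Rightarrow> real" where
  "Zval r = (case quotient_of r of (a, b) \<Rightarrow>
      Min ((\<lambda>q::int. of_int q * dist_int (of_int q * of_int a / of_int b)) ` {0<..<b}))"

definition Z_spectrum :: "real set" where
  "Z_spectrum = {Zval r | r. snd (quotient_of r) \<ge> 2}"

definition markoff_triple :: "nat \<Rightarrow> nat \<Rightarrow> nat \<Rightarrow> bool" where
  "markoff_triple x y z \<longleftrightarrow> x > 0 \<and> y > 0 \<and> z > 0 \<and> x^2 + y^2 + z^2 = 3 * x * y * z"

definition markoff_number :: "nat \<Rightarrow> bool" where
  "markoff_number m \<longleftrightarrow> (\<exists>x y z. markoff_triple x y z \<and> (m = x \<or> m = y \<or> m = z))"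

end

theory Submission
  imports Defs
begin

text \<open>
  The constant of \<open>a/b\<close> is the least nonzero absolute value of the indefinite form \<open>x (a x - b y) / b\<close> of
  discriminant 1 on integer vectors.  Its geodesic joins two cusps of the modular torus, and the values
  are read off at the vertices of any ideal triangulation of the torus; triangulations correspond to
  Markoff triples, and a flip of an edge is a Vieta move.

  Suppose that the constant is at least \<open>t > 1/3\<close>.  If the geodesic cuts off the vertex opposite to the
  longest edge \<open>c\<close> of a triangulation, then \<open>t\<^sup>2 (9 c\<^sup>2 - 4) \<le> c\<^sup>2\<close>, which bounds \<open>c\<close>.  Following the
  geodesic, either a flip leads to the same situation with a larger \<open>c\<close>, or the geodesic never crosses the
  edges \<open>c\<close> and joins the two end vertices \<open>v\<^sub>0\<close> and \<open>v\<^sub>M\<close> of a strip of triangles \<open>v\<^sub>i v\<^sub>i\<^sub>+\<^sub>1 v\<^sub>i\<^sub>+\<^sub>2\<close>.  Then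
  the value at \<open>v\<^sub>i\<close> is \<open>\<plusminus> det (v\<^sub>0, v\<^sub>i) det (v\<^sub>i, v\<^sub>M) / det (v\<^sub>0, v\<^sub>M)\<close>, and Ptolemy's relation shows that \<open>v\<^sub>2\<close>
  gives the constant, namely \<open>c det (v\<^sub>0, v\<^sub>M\<^sub>-\<^sub>2) / det (v\<^sub>0, v\<^sub>M)\<close>.  As \<open>M\<close> grows it converges to
  \<open>2 c / (sqrt (9 c\<^sup>2 - 4) + 3 c)\<close>, and conversely all these numbers belong to the spectrum.
\<close>

section \<open>Markoff triples\<close>

definition real_markoff_triple :: "real \<Rightarrow> real \<Rightarrow> real \<Rightarrow> bool" where
  "real_markoff_triple x y s \<longleftrightarrow>
     x \<in> \<int> \<and> y \<in> \<int> \<and> s \<in> \<int> \<and> 1 \<le> x \<and> 1 \<le> y \<and> 1 \<le> s \<and> x\<^sup>2 + y\<^sup>2 + s\<^sup>2 = 3 * x * y * s"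

lemma real_markoff_triple_ones [simp]: "real_markoff_triple 1 1 1"
  by (simp add: real_markoff_triple_def)

lemma real_markoff_triple_ge_1:
  assumes "real_markoff_triple x y s"
  shows "1 \<le> x" "1 \<le> y" "1 \<le> s"
  using assms by (auto simp: real_markoff_triple_def)

lemma real_markoff_triple_eq: "real_markoff_triple x y s \<Longrightarrow> x\<^sup>2 + y\<^sup>2 + s\<^sup>2 = 3 * x * y * s"
  by (simp add: real_markoff_triple_def)

lemma real_markoff_triple_vieta: "real_markoff_triple x y s \<Longrightarrow> x\<^sup>2 + y\<^sup>2 = s * (3 * x * y - s)"
  by (simp add: real_markoff_triple_def algebra_simps power2_eq_square)

lemma real_markoff_triple_vieta_div:
  assumes "real_markoff_triple x y s"
  shows "(x\<^sup>2 + y\<^sup>2) / s = 3 * x * y - s"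
  using real_markoff_triple_vieta[OF assms] real_markoff_triple_ge_1(3)[OF assms] by simp

lemma real_markoff_triple_rotate: "real_markoff_triple x y s \<Longrightarrow> real_markoff_triple y s x"
  and real_markoff_triple_swap: "real_markoff_triple x y s \<Longrightarrow> real_markoff_triple y x s"
  by (auto simp: real_markoff_triple_def algebra_simps)

lemma Ints_pos_imp_ge_1: "z \<in> \<int> \<Longrightarrow> 0 < z \<Longrightarrow> (1::real) \<le> z"
  by (auto elim!: Ints_cases)

lemma real_markoff_triple_flip:
  assumes triple: "real_markoff_triple x y s"
  shows "real_markoff_triple x y (3 * x * y - s)"
proof -
  note ge_1 = real_markoff_triple_ge_1[OF triple]
  have "0 < s * (3 * x * y - s)"
    using ge_1 unfolding real_markoff_triple_vieta[OF triple, symmetric]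
    by (simp add: sum_power2_gt_zero_iff)
  then have "0 < 3 * x * y - s"
    using ge_1 by (simp add: zero_less_mult_iff)
  moreover have "3 * x * y - s \<in> \<int>"
    using triple by (auto simp: real_markoff_triple_def)
  ultimately show ?thesis
    using triple Ints_pos_imp_ge_1[of "3 * x * y - s"]
    by (auto simp: real_markoff_triple_def algebra_simps power2_eq_square)
qed

lemma real_markoff_triple_descent_sorted:
  assumes triple: "real_markoff_triple x y s" and "x \<le> y" "y \<le> s" "s \<noteq> 1"
  shows "3 * x * y - s < s"
proof (rule ccontr)
  assume not_less: "\<not> 3 * x * y - s < s"
  then have "0 \<le> (y - s) * (y - (3 * x * y - s))"
    using \<open>y \<le> s\<close> by (intro mult_nonpos_nonpos) auto
  also have "\<dots> = (x\<^sup>2 - y\<^sup>2) + 3 * y\<^sup>2 * (1 - x)"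
    using real_markoff_triple_eq[OF triple] by (simp add: algebra_simps power2_eq_square)
  finally have "0 \<le> (x\<^sup>2 - y\<^sup>2) + 3 * y\<^sup>2 * (1 - x)" .
  moreover have "x\<^sup>2 \<le> y\<^sup>2"
    using real_markoff_triple_ge_1[OF triple] \<open>x \<le> y\<close> by (intro power_mono) auto
  moreover have "3 * y\<^sup>2 * (1 - x) \<le> 0"
    using real_markoff_triple_ge_1[OF triple] by (intro mult_nonneg_nonpos) auto
  ultimately have "x\<^sup>2 = y\<^sup>2" "3 * y\<^sup>2 * (1 - x) = 0"
    by linarith+
  from \<open>x\<^sup>2 = y\<^sup>2\<close> have "x = y"
    by (rule power2_eq_imp_eq) (use real_markoff_triple_ge_1[OF triple] in linarith)+
  moreover have "x = 1"
    using \<open>3 * y\<^sup>2 * (1 - x) = 0\<close> real_markoff_triple_ge_1(2)[OF triple] by auto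
  ultimately have "y = 1" by simp
  have "(s - 1) * (s - 2) = 0"
    using real_markoff_triple_eq[OF triple] unfolding \<open>x = 1\<close> \<open>y = 1\<close>
    by (simp add: algebra_simps power2_eq_square)
  then show False
    using not_less \<open>x = 1\<close> \<open>y = 1\<close> \<open>s \<noteq> 1\<close> by auto
qed

lemma real_markoff_triple_descent:
  assumes "real_markoff_triple x y s" "x \<le> s" "y \<le> s" "s \<noteq> 1"
  shows "3 * x * y - s < s"
proof (cases "x \<le> y")
  case True
  then show ?thesis
    using real_markoff_triple_descent_sorted assms by blast
next
  case False
  then have "3 * y * x - s < s"
    using real_markoff_triple_descent_sorted real_markoff_triple_swap[OF assms(1)] assms by simp
  then show ?thesis
    by (simp add: mult_ac)
qed

lemma real_markoff_triple_iff: "real_markoff_triple (real x) (real y) (real z) \<longleftrightarrow> markoff_triple x y z"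
proof -
  have "(real x)\<^sup>2 + (real y)\<^sup>2 + (real z)\<^sup>2 = 3 * real x * real y * real z \<longleftrightarrow>
      real (x\<^sup>2 + y\<^sup>2 + z\<^sup>2) = real (3 * x * y * z)"
    by simp
  then show ?thesis
    unfolding real_markoff_triple_def markoff_triple_def of_nat_eq_iff by auto
qed

lemma real_markoff_tripleE:
  assumes "real_markoff_triple x y s"
  obtains i j k where "markoff_triple i j k" "x = real i" "y = real j" "s = real k"
proof -
  have "z = real (nat \<lfloor>z\<rfloor>)" if "z \<in> \<int>" "1 \<le> z" for z :: real
    using that by (auto elim!: Ints_cases)
  then have "x = real (nat \<lfloor>x\<rfloor>)" "y = real (nat \<lfloor>y\<rfloor>)" "s = real (nat \<lfloor>s\<rfloor>)"
    using assms by (auto simp: real_markoff_triple_def)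
  then show thesis
    using that assms real_markoff_triple_iff by metis
qed

lemma markoff_numberE:
  assumes "markoff_number m"
  obtains x y where "markoff_triple x y m"
proof -
  obtain x y z where triple: "markoff_triple x y z" and m: "m = x \<or> m = y \<or> m = z"
    using assms by (auto simp: markoff_number_def)
  have "markoff_triple y z x" "markoff_triple z x y"
    using triple real_markoff_triple_rotate unfolding real_markoff_triple_iff[symmetric] by blast+
  then show thesis
    using that triple m by blast
qed

lemma markoff_triple_descent:
  assumes triple: "markoff_triple x y m" and "m < x" "y \<le> x"
  shows "\<exists>x'<x. markoff_triple x' y m"
proof -
  have rotated: "real_markoff_triple (real y) (real m) (real x)"
    using triple real_markoff_triple_iff real_markoff_triple_rotate by blast
  have "1 \<le> m"
    using triple by (simp add: markoff_triple_def)
  then have smaller: "3 * real y * real m - real x < real x"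
    using assms rotated by (intro real_markoff_triple_descent) auto
  have flipped: "real_markoff_triple (real y) (real m) (3 * real y * real m - real x)"
    by (rule real_markoff_triple_flip[OF rotated])
  then obtain x' where x': "3 * real y * real m - real x = real x'"
    by (auto elim: real_markoff_tripleE)
  then have "markoff_triple x' y m"
    using flipped real_markoff_triple_iff real_markoff_triple_rotate by metis
  then show ?thesis
    using smaller x' by auto
qed

lemma markoff_triple_imp_maximal_triple:
  assumes "markoff_triple x y m"
  shows "\<exists>\<sigma> \<tau>. real_markoff_triple \<sigma> \<tau> (real m) \<and> \<sigma> \<le> real m \<and> \<tau> \<le> real m"
  using assms
proof (induction "x + y" arbitrary: x y rule: less_induct)
  case less
  have swapped: "markoff_triple y x m"
    using less.prems real_markoff_triple_iff real_markoff_triple_swap by blast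
  consider (maximal) "x \<le> m" "y \<le> m" | (left) "m < x" "y \<le> x" | (right) "m < y" "x \<le> y"
    by linarith
  then show ?case
  proof cases
    case maximal
    then show ?thesis
      using less.prems real_markoff_triple_iff of_nat_le_iff by blast
  next
    case left
    then show ?thesis
      using markoff_triple_descent[OF less.prems] less.hyps by (meson add_less_mono1)
  next
    case right
    then obtain y' where "y' < y" "markoff_triple y' x m"
      using markoff_triple_descent[OF swapped] by blast
    then show ?thesis
      using less.hyps[of y' x] by simp
  qed
qed

lemma finite_Ints_atLeastAtMost: "finite {z \<in> \<int>. a \<le> z \<and> z \<le> (b::real)}"
proof (rule finite_subset)
  show "{z \<in> \<int>. a \<le> z \<and> z \<le> b} \<subseteq> of_int ` {\<lceil>a\<rceil>..\<lfloor>b\<rfloor>}"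
    by (auto elim!: Ints_cases simp: le_floor_iff ceiling_le_iff)
qed simp

lemma finite_bounded_real_markoff_triples:
  "finite {(x, y, s). real_markoff_triple x y s \<and> x \<le> s \<and> y \<le> s \<and> s \<le> K}"
proof (rule finite_subset)
  let ?B = "{z \<in> \<int>. 1 \<le> z \<and> z \<le> K}"
  show "{(x, y, s). real_markoff_triple x y s \<and> x \<le> s \<and> y \<le> s \<and> s \<le> K} \<subseteq> ?B \<times> ?B \<times> ?B"
    by (auto simp: real_markoff_triple_def)
  show "finite (?B \<times> ?B \<times> ?B)"
    by (intro finite_cartesian_product finite_Ints_atLeastAtMost)
qed

text \<open>The larger root of \<open>z\<^sup>2 - 3 c z + 1\<close>.\<close>

definition rho :: "real \<Rightarrow> real" where
  "rho c = (3 * c + sqrt (9 * c\<^sup>2 - 4)) / 2"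

lemma sqrt_discriminant_ge:
  assumes "1 \<le> c"
  shows "c \<le> sqrt (9 * c\<^sup>2 - 4)"
proof (rule real_le_rsqrt)
  show "c\<^sup>2 \<le> 9 * c\<^sup>2 - 4"
    using one_le_power[OF assms, of 2] by simp
qed

lemma rho_ge: "1 \<le> c \<Longrightarrow> 2 * c \<le> rho c"
  using sqrt_discriminant_ge by (simp add: rho_def)

lemma rho_gt_1: "1 \<le> c \<Longrightarrow> 1 < rho c"
  using rho_ge[of c] by simp

lemma rho_root:
  assumes "1 \<le> c"
  shows "(rho c)\<^sup>2 + 1 = 3 * c * rho c"
proof -
  have "(sqrt (9 * c\<^sup>2 - 4))\<^sup>2 = 9 * c\<^sup>2 - 4"
    using one_le_power[OF assms, of 2] by (intro real_sqrt_pow2) simp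
  then show ?thesis
    by (simp add: rho_def field_simps power2_eq_square)
qed

lemma rho_add_inverse:
  assumes "1 \<le> c"
  shows "rho c + 1 / rho c = 3 * c"
  using rho_root[OF assms] rho_gt_1[OF assms] by (simp add: field_simps power2_eq_square)

lemma limit_value_eq: "2 * c / (sqrt (9 * c\<^sup>2 - 4) + 3 * c) = c / rho c"
proof -
  have "sqrt (9 * c\<^sup>2 - 4) + 3 * c = 2 * rho c"
    by (simp add: rho_def)
  then show ?thesis by simp
qed

lemma rho_irrational:
  assumes "c \<in> \<int>" "1 \<le> c"
  shows "rho c \<notin> \<rat>"
proof
  assume "rho c \<in> \<rat>"
  then obtain a b :: int where ab: "0 < b" "coprime a b" "rho c = of_int a / of_int b"
    by (rule Rats_cases')
  obtain k where c_eq: "c = of_int k"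
    using assms(1) by (rule Ints_cases)
  have a_eq: "of_int a = rho c * of_int b"
    using ab(1,3) by simp
  have "real_of_int (a\<^sup>2 + b\<^sup>2) = ((rho c)\<^sup>2 + 1) * (of_int b)\<^sup>2"
    by (simp add: a_eq algebra_simps)
  also have "\<dots> = real_of_int (3 * k * a * b)"
    unfolding rho_root[OF assms(2)] by (simp add: a_eq c_eq power2_eq_square)
  finally have "real_of_int (a\<^sup>2 + b\<^sup>2) = real_of_int (3 * k * a * b)" .
  then have vieta: "a\<^sup>2 + b\<^sup>2 = 3 * k * a * b"
    by (simp only: of_int_eq_iff)
  have "a dvd b\<^sup>2"
  proof -
    have "b\<^sup>2 = a * (3 * k * b - a)"
      using vieta by (simp add: algebra_simps power2_eq_square)
    then show ?thesis by (rule dvdI)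
  qed
  then have "is_unit a"
    using ab(2) by (metis coprime_absorb_left coprime_power_right_iff)
  then have "\<bar>a\<bar> = 1"
    by simp
  then have "\<bar>real_of_int a\<bar> \<le> of_int b"
    using ab(1) by linarith
  then have "rho c \<le> 1"
    unfolding ab(3) using ab(1) by simp
  then show False
    using rho_gt_1[OF assms(2)] by simp
qed

section \<open>Triangles labelled by a quadratic form\<close>

text \<open>
  \<open>Triangle x P y Q s R\<close> is a triangle with vertices \<open>p\<close>, \<open>q\<close>, \<open>r\<close> in the plane: the form takes the
  values \<open>P\<close>, \<open>Q\<close>, \<open>R\<close> there, and \<open>x\<close>, \<open>y\<close>, \<open>s\<close> are the absolute determinants of the opposite edges
  \<open>qr\<close>, \<open>rp\<close>, \<open>pq\<close>.  The vertices themselves are not recorded.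
\<close>

datatype triangle = Triangle real real real real real real

fun mirror :: "triangle \<Rightarrow> triangle" where
  "mirror (Triangle x P y Q s R) = Triangle y Q x P s R"

fun turn :: "triangle \<Rightarrow> triangle" where
  "turn (Triangle x P y Q s R) = Triangle y Q s R x P"

text \<open>
  \<open>cross\<close> passes to the neighbouring triangle over the edge \<open>pq\<close>, whose new vertex is \<open>(x q - y p) / s\<close>
  (up to sign); the rotation that swaps \<open>p\<close> and \<open>q\<close> exchanges the two triangles, hence the exchange
  of \<open>x\<close> and \<open>y\<close>.  \<open>flip\<close> replaces the diagonal \<open>pq\<close> of the same quadrilateral by the other one.
\<close>

fun cross :: "triangle \<Rightarrow> triangle" where
  "cross (Triangle x P y Q s R) = Triangle y P x Q s ((x\<^sup>2 + y\<^sup>2) * (P + Q) / s\<^sup>2 - R)"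

fun flip :: "triangle \<Rightarrow> triangle" where
  "flip (Triangle x P y Q s R) =
     Triangle x R y ((x\<^sup>2 + y\<^sup>2) * (P + Q) / s\<^sup>2 - R) ((x\<^sup>2 + y\<^sup>2) / s) P"

fun vertex_values :: "triangle \<Rightarrow> real set" where
  "vertex_values (Triangle x P y Q s R) = {P, Q, R}"

fun markoff :: "triangle \<Rightarrow> bool" where
  "markoff (Triangle x P y Q s R) \<longleftrightarrow> real_markoff_triple x y s"

text \<open>The form has discriminant 1; the condition is symmetric in the three vertices.\<close>

fun unit_disc :: "triangle \<Rightarrow> bool" where
  "unit_disc (Triangle x P y Q s R) \<longleftrightarrow>
     (s\<^sup>2 * R - x\<^sup>2 * P - y\<^sup>2 * Q)\<^sup>2 = x\<^sup>2 * y\<^sup>2 * (s\<^sup>2 + 4 * P * Q)"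

fun det_product :: "triangle \<Rightarrow> real" where
  "det_product (Triangle x P y Q s R) = x * y * s"

fun max_det :: "triangle \<Rightarrow> real" where
  "max_det (Triangle x P y Q s R) = max x (max y s)"

lemma markoff_turn: "markoff C \<Longrightarrow> markoff (turn C)"
  and markoff_mirror: "markoff C \<Longrightarrow> markoff (mirror C)"
  and markoff_cross: "markoff C \<Longrightarrow> markoff (cross C)"
  by (cases C; auto intro: real_markoff_triple_rotate real_markoff_triple_swap)+

lemma markoff_flip: "markoff C \<Longrightarrow> markoff (flip C)"
  by (cases C) (auto simp: real_markoff_triple_vieta_div intro: real_markoff_triple_flip)

lemma cross_markoff_triple:
  assumes "real_markoff_triple x y s"
  shows "cross (Triangle x P y Q s R) = Triangle y P x Q s ((3 * x * y - s) / s * (P + Q) - R)"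
  using real_markoff_triple_vieta[OF assms] real_markoff_triple_ge_1(3)[OF assms]
  by (simp add: power2_eq_square)

lemma flip_markoff_triple:
  assumes "real_markoff_triple x y s"
  shows "flip (Triangle x P y Q s R) =
    Triangle x R y ((3 * x * y - s) / s * (P + Q) - R) (3 * x * y - s) P"
  using real_markoff_triple_vieta[OF assms] real_markoff_triple_ge_1(3)[OF assms]
  by (simp add: power2_eq_square)

lemma cross_cross: "markoff C \<Longrightarrow> cross (cross C) = C"
  by (cases C) (auto simp: add.commute dest: real_markoff_triple_ge_1(3))

lemma turn_turn_turn [simp]: "turn (turn (turn C)) = C"
  and mirror_mirror [simp]: "mirror (mirror C) = C"
  and cross_mirror: "cross (mirror C) = mirror (cross C)"
  and turn_mirror: "turn (mirror C) = mirror (turn (turn C))"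
  by (cases C; simp add: add.commute)+

lemma flip_flip:
  assumes "markoff C"
  shows "flip (flip C) = C"
proof (cases C)
  case (Triangle x P y Q s R)
  then have triple: "real_markoff_triple x y s"
    using assms by simp
  note triple' = real_markoff_triple_flip[OF triple]
  show ?thesis
    unfolding Triangle flip_markoff_triple[OF triple] flip_markoff_triple[OF triple']
    using real_markoff_triple_ge_1[OF triple] real_markoff_triple_ge_1[OF triple'] by (simp add: field_simps)
qed

lemma unit_disc_mirror: "unit_disc C \<Longrightarrow> unit_disc (mirror C)"
  by (cases C) (simp add: algebra_simps)

lemma unit_disc_turn: "unit_disc C \<Longrightarrow> unit_disc (turn C)"
  by (cases C) (simp add: algebra_simps power2_eq_square)

lemma unit_disc_cross:
  assumes "markoff C" "unit_disc C"
  shows "unit_disc (cross C)"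
proof (cases C)
  case (Triangle x P y Q s R)
  then have "s \<noteq> 0"
    using assms(1) real_markoff_triple_ge_1(3)[of x y s] by auto
  then have "s\<^sup>2 * ((x\<^sup>2 + y\<^sup>2) * (P + Q) / s\<^sup>2 - R) - y\<^sup>2 * P - x\<^sup>2 * Q = - (s\<^sup>2 * R - x\<^sup>2 * P - y\<^sup>2 * Q)"
    by (simp add: field_simps)
  then show ?thesis
    using assms(2) unfolding Triangle unit_disc.simps cross.simps
    by (simp only: power2_minus) (simp add: mult_ac)
qed

lemma unit_disc_flip:
  assumes "markoff C" "unit_disc C"
  shows "unit_disc (flip C)"
proof (cases C)
  case (Triangle x P y Q s R)
  then have triple: "real_markoff_triple x y s"
    using assms(1) by simp
  define t where "t = 3 * x * y - s"
  define R' where "R' = t / s * (P + Q) - R"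
  have "s \<noteq> 0"
    using real_markoff_triple_ge_1(3)[OF triple] by simp
  then have sR': "s * R' = t * (P + Q) - s * R"
    by (simp add: R'_def field_simps)
  have vieta: "x\<^sup>2 + y\<^sup>2 = s * t"
    using real_markoff_triple_vieta[OF triple] by (simp add: t_def)
  have disc: "(s\<^sup>2 * R - x\<^sup>2 * P - y\<^sup>2 * Q)\<^sup>2 = x\<^sup>2 * y\<^sup>2 * (s\<^sup>2 + 4 * P * Q)"
    using assms(2) Triangle by simp
  have "s\<^sup>2 * (s\<^sup>2 * (t\<^sup>2 * P - x\<^sup>2 * R - y\<^sup>2 * R')\<^sup>2) = s\<^sup>2 * (s\<^sup>2 * (x\<^sup>2 * y\<^sup>2 * (t\<^sup>2 + 4 * R * R')))"
    using sR' vieta disc by algebra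
  then have "(t\<^sup>2 * P - x\<^sup>2 * R - y\<^sup>2 * R')\<^sup>2 = x\<^sup>2 * y\<^sup>2 * (t\<^sup>2 + 4 * R * R')"
    using \<open>s \<noteq> 0\<close> by simp
  then show ?thesis
    unfolding Triangle flip_markoff_triple[OF triple] t_def[symmetric] R'_def[symmetric] by simp
qed

definition arrangements :: "triangle \<Rightarrow> triangle set" where
  "arrangements D = {D, turn D, turn (turn D), mirror D, mirror (turn D), mirror (turn (turn D))}"

lemma arrangements_self: "C \<in> arrangements C"
  by (simp add: arrangements_def)

lemma arrangements_mirror: "C \<in> arrangements D \<Longrightarrow> mirror C \<in> arrangements D"
  and arrangements_turn: "C \<in> arrangements D \<Longrightarrow> turn C \<in> arrangements D"
  by (auto simp: arrangements_def turn_mirror)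

lemma arrangements_trans: "A \<in> arrangements B \<Longrightarrow> B \<in> arrangements D \<Longrightarrow> A \<in> arrangements D"
  unfolding arrangements_def[of B] by (auto intro: arrangements_mirror arrangements_turn)

definition neighbours :: "triangle \<Rightarrow> triangle set" where
  "neighbours C = {cross C, cross (turn C), cross (turn (turn C))}"

lemma cross_arrangements:
  assumes "C \<in> arrangements D"
  shows "\<exists>N\<in>neighbours D. cross C \<in> arrangements N"
  using assms by (auto simp: arrangements_def neighbours_def cross_mirror)

lemma vertex_values_turn [simp]: "vertex_values (turn C) = vertex_values C"
  and vertex_values_mirror [simp]: "vertex_values (mirror C) = vertex_values C"
  by (cases C; auto)+

lemma det_product_simps [simp]:
  "det_product (turn C) = det_product C"
  "det_product (mirror C) = det_product C"
  "det_product (cross C) = det_product C"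
  by (cases C; simp)+

lemma max_det_simps [simp]:
  "max_det (turn C) = max_det C"
  "max_det (mirror C) = max_det C"
  "max_det (cross C) = max_det C"
  by (cases C; simp add: max.commute max.left_commute)+

lemma arrangements_invariants:
  assumes "C \<in> arrangements D"
  shows "vertex_values C = vertex_values D" "det_product C = det_product D" "max_det C = max_det D"
    "markoff D \<Longrightarrow> markoff C"
  using assms by (auto simp: arrangements_def intro: markoff_turn markoff_mirror)

inductive_set orbit :: "triangle \<Rightarrow> triangle set" for C0 where
  base: "C0 \<in> orbit C0"
| mirror: "C \<in> orbit C0 \<Longrightarrow> mirror C \<in> orbit C0"
| turn: "C \<in> orbit C0 \<Longrightarrow> turn C \<in> orbit C0"
| cross: "C \<in> orbit C0 \<Longrightarrow> cross C \<in> orbit C0"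

lemma orbit_markoff: "C \<in> orbit C0 \<Longrightarrow> markoff C0 \<Longrightarrow> markoff C"
  by (induction rule: orbit.induct) (auto intro: markoff_turn markoff_mirror markoff_cross)

lemma orbit_unit_disc: "C \<in> orbit C0 \<Longrightarrow> markoff C0 \<Longrightarrow> unit_disc C0 \<Longrightarrow> unit_disc C"
  by (induction rule: orbit.induct) (auto intro: unit_disc_mirror unit_disc_turn unit_disc_cross orbit_markoff)

lemma orbit_det_product: "C \<in> orbit C0 \<Longrightarrow> det_product C = det_product C0"
  and orbit_max_det: "C \<in> orbit C0 \<Longrightarrow> max_det C = max_det C0"
  by (induction rule: orbit.induct) simp_all

lemma orbit_arrangements: "D \<in> orbit C0 \<Longrightarrow> C \<in> arrangements D \<Longrightarrow> C \<in> orbit C0"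
  by (auto simp: arrangements_def intro: orbit.intros)

lemma orbit_trans: "C2 \<in> orbit C1 \<Longrightarrow> C1 \<in> orbit C0 \<Longrightarrow> C2 \<in> orbit C0"
  by (induction rule: orbit.induct) (auto intro: orbit.intros)

lemma orbit_sym:
  assumes "C \<in> orbit C0" "markoff C0"
  shows "C0 \<in> orbit C"
  using assms
proof (induction rule: orbit.induct)
  case base
  show ?case by (rule orbit.base)
next
  case (mirror C)
  have "C \<in> orbit (mirror C)"
    by (metis orbit.base orbit.mirror mirror_mirror)
  with mirror show ?case using orbit_trans by blast
next
  case (turn C)
  have "C \<in> orbit (turn C)"
    by (metis orbit.base orbit.turn turn_turn_turn)
  with turn show ?case using orbit_trans by blast
next
  case (cross C)
  then have "cross (cross C) = C"
    using cross_cross orbit_markoff by blast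
  then have "C \<in> orbit (cross C)"
    by (metis orbit.base orbit.cross)
  with cross show ?case using orbit_trans by blast
qed

definition orbit_values :: "triangle \<Rightarrow> real set" where
  "orbit_values C0 = (\<Union>C\<in>orbit C0. vertex_values C)"

lemma vertex_values_subset_orbit_values: "C \<in> orbit C0 \<Longrightarrow> vertex_values C \<subseteq> orbit_values C0"
  unfolding orbit_values_def by blast

lemma orbit_values_orbit:
  assumes "C \<in> orbit C0" "markoff C0"
  shows "orbit_values C = orbit_values C0"
  using assms orbit_sym[OF assms] unfolding orbit_values_def by (auto intro: orbit_trans)

lemma vertex_values_flip_Rats: "markoff C \<Longrightarrow> vertex_values C \<subseteq> \<rat> \<Longrightarrow> vertex_values (flip C) \<subseteq> \<rat>"
  and vertex_values_cross_Rats: "markoff C \<Longrightarrow> vertex_values C \<subseteq> \<rat> \<Longrightarrow> vertex_values (cross C) \<subseteq> \<rat>"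
  using Ints_subset_Rats
  by (cases C;
      auto simp: real_markoff_triple_def power2_eq_square intro!: Rats_diff Rats_divide Rats_mult Rats_add)+

lemma orbit_values_Rats:
  assumes "markoff C0" "vertex_values C0 \<subseteq> \<rat>"
  shows "orbit_values C0 \<subseteq> \<rat>"
proof -
  have "vertex_values C \<subseteq> \<rat>" if "C \<in> orbit C0" for C
    using that assms
    by (induction rule: orbit.induct) (auto dest: vertex_values_cross_Rats[OF orbit_markoff, THEN subsetD])
  then show ?thesis
    unfolding orbit_values_def by blast
qed

text \<open>
  The Markoff equation makes flips compatible with crossing edges, so that all triangulations see the
  same values.
\<close>

lemma cross_flip:
  assumes "markoff C"
  shows "cross (flip C) = mirror (flip (mirror (cross C)))"
    and "cross (turn (flip C)) = turn (turn (flip (turn (mirror (cross (turn (turn (cross C))))))))"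
    and "cross (turn (turn (flip C))) = turn (mirror (flip (turn (mirror (cross (turn (turn C)))))))"
proof -
  obtain x P y Q s R where C_eq: "C = Triangle x P y Q s R" by (cases C)
  then have triple: "real_markoff_triple x y s"
    using assms by simp
  define t where "t = 3 * x * y - s"
  have triple': "real_markoff_triple x y t"
    unfolding t_def by (rule real_markoff_triple_flip[OF triple])
  have s_eq: "3 * x * y - t = s"
    by (simp add: t_def)
  have nonzero: "s \<noteq> 0" "t \<noteq> 0" "x \<noteq> 0" "y \<noteq> 0"
    using real_markoff_triple_ge_1[OF triple] real_markoff_triple_ge_1(3)[OF triple'] by auto
  note rotate = real_markoff_triple_rotate and swap = real_markoff_triple_swap
  note across_pq = cross_markoff_triple[OF triple, folded t_def] flip_markoff_triple[OF triple, folded t_def]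
  show "cross (flip C) = mirror (flip (mirror (cross C)))"
    unfolding C_eq across_pq mirror.simps cross_markoff_triple[OF triple'] s_eq
    using nonzero by (simp add: field_simps)
  show "cross (turn (turn (flip C))) = turn (mirror (flip (turn (mirror (cross (turn (turn C)))))))"
    unfolding C_eq across_pq mirror.simps turn.simps
      cross_markoff_triple[OF rotate[OF rotate[OF triple']]] cross_markoff_triple[OF rotate[OF rotate[OF triple]]]
    using nonzero by (simp add: field_simps)
  show "cross (turn (flip C)) = turn (turn (flip (turn (mirror (cross (turn (turn (cross C))))))))"
    unfolding C_eq across_pq mirror.simps turn.simps cross_markoff_triple[OF rotate[OF triple']]
      cross_markoff_triple[OF swap[OF rotate[OF triple]]] flip_markoff_triple[OF swap[OF triple]]
    using nonzero by (simp add: field_simps t_def)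
qed

lemma orbit_flip:
  assumes "C' \<in> orbit (flip C0)" "markoff C0"
  shows "\<exists>C\<in>orbit C0. C' \<in> arrangements (flip C)"
  using assms
proof (induction rule: orbit.induct)
  case base
  show ?case using orbit.base arrangements_self by blast
next
  case (mirror C)
  then show ?case by (blast intro: arrangements_mirror)
next
  case (turn C)
  then show ?case by (blast intro: arrangements_turn)
next
  case (cross C')
  then obtain C where C: "C \<in> orbit C0" "C' \<in> arrangements (flip C)" by blast
  define flipped where "flipped = {mirror (cross C), turn (mirror (cross (turn (turn (cross C))))),
    turn (mirror (cross (turn (turn C))))}"
  have "flipped \<subseteq> orbit C0"
    using C(1) by (auto simp: flipped_def intro!: orbit.intros)
  have "markoff C"
    using C(1) cross.prems orbit_markoff by blast
  then have "\<exists>D\<in>flipped. N \<in> arrangements (flip D)" if "N \<in> neighbours (flip C)" for N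
    using that by (auto simp: neighbours_def flipped_def cross_flip arrangements_def turn_mirror)
  then have "\<exists>D\<in>flipped. cross C' \<in> arrangements (flip D)"
    using cross_arrangements[OF C(2)] arrangements_trans by blast
  then show ?case
    using \<open>flipped \<subseteq> orbit C0\<close> by blast
qed

lemma vertex_values_flip: "vertex_values (flip C) \<subseteq> vertex_values C \<union> vertex_values (cross C)"
  by (cases C) auto

lemma orbit_values_flip_subset:
  assumes "markoff C0"
  shows "orbit_values (flip C0) \<subseteq> orbit_values C0"
proof
  fix v assume "v \<in> orbit_values (flip C0)"
  then obtain C' where C': "C' \<in> orbit (flip C0)" "v \<in> vertex_values C'"
    by (auto simp: orbit_values_def)
  then obtain C where C: "C \<in> orbit C0" "C' \<in> arrangements (flip C)"
    using orbit_flip[OF _ assms] by blast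
  then have "v \<in> vertex_values C \<union> vertex_values (cross C)"
    using C' arrangements_invariants(1) vertex_values_flip by blast
  then show "v \<in> orbit_values C0"
    using C(1) orbit.cross unfolding orbit_values_def by blast
qed

lemma orbit_values_flip:
  assumes "markoff C"
  shows "orbit_values (flip C) = orbit_values C"
proof
  show "orbit_values C \<subseteq> orbit_values (flip C)"
    using orbit_values_flip_subset[OF markoff_flip[OF assms]] flip_flip[OF assms] by simp
qed (rule orbit_values_flip_subset[OF assms])

section \<open>The Farey triangulation and the spectrum\<close>

definition least_abs :: "real set \<Rightarrow> real" where
  "least_abs S = Inf {\<bar>v\<bar> | v. v \<in> S \<and> v \<noteq> 0}"

definition abs_gap :: "real \<Rightarrow> real set \<Rightarrow> bool" where
  "abs_gap t S \<longleftrightarrow> (\<forall>v\<in>S. v \<noteq> 0 \<longrightarrow> t \<le> \<bar>v\<bar>)"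

lemma abs_gap_least_abs: "abs_gap (least_abs S) S"
  unfolding abs_gap_def least_abs_def by (auto intro!: cInf_lower bdd_belowI[of _ 0])

lemma least_abs_eqI:
  assumes "v \<in> S" "v \<noteq> 0" "\<bar>v\<bar> = m" "abs_gap m S"
  shows "least_abs S = m"
  unfolding least_abs_def using assms by (intro cInf_eq_minimum) (auto simp: abs_gap_def)

definition fraction_form :: "real \<Rightarrow> int \<Rightarrow> int \<Rightarrow> real" where
  "fraction_form \<beta> x y = of_int x * (\<beta> * of_int x - of_int y)"

lemma fraction_form_minus: "fraction_form \<beta> (- x) (- y) = fraction_form \<beta> x y"
  by (simp add: fraction_form_def algebra_simps)

lemma fraction_form_mult: "fraction_form \<beta> (k * x) (k * y) = (of_int k)\<^sup>2 * fraction_form \<beta> x y"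
  by (simp add: fraction_form_def algebra_simps power2_eq_square)

definition farey_triangle :: "real \<Rightarrow> int \<Rightarrow> int \<Rightarrow> int \<Rightarrow> int \<Rightarrow> triangle" where
  "farey_triangle \<beta> p p' q q' =
     Triangle 1 (fraction_form \<beta> p p') 1 (fraction_form \<beta> q q') 1 (fraction_form \<beta> (p + q) (p' + q'))"

abbreviation farey :: "real \<Rightarrow> triangle" where
  "farey \<beta> \<equiv> Triangle 1 \<beta> 1 0 1 (\<beta> - 1)"

lemma farey_eq: "farey \<beta> = farey_triangle \<beta> 1 0 0 1"
  by (simp add: farey_triangle_def fraction_form_def)

lemma farey_triangle_mirror: "mirror (farey_triangle \<beta> p p' q q') = farey_triangle \<beta> q q' p p'"
  and farey_triangle_turn: "turn (farey_triangle \<beta> p p' q q') = farey_triangle \<beta> q q' (- p - q) (- p' - q')"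
  and farey_triangle_cross: "cross (farey_triangle \<beta> p p' q q') = farey_triangle \<beta> p p' (- q) (- q')"
  by (simp_all add: farey_triangle_def fraction_form_def algebra_simps)

lemma farey_triangle_left_child:
  "mirror (cross (turn (turn (farey_triangle \<beta> p p' q q')))) = farey_triangle \<beta> p p' (p + q) (p' + q')"
  and farey_triangle_right_child:
  "mirror (cross (turn (farey_triangle \<beta> p p' q q'))) = farey_triangle \<beta> (p + q) (p' + q') q q'"
  by (simp_all add: farey_triangle_def fraction_form_def algebra_simps)

lemma orbit_farey:
  assumes "C \<in> orbit (farey \<beta>)"
  shows "\<exists>p p' q q'. \<bar>p * q' - p' * q\<bar> = 1 \<and> C = farey_triangle \<beta> p p' q q'"
  using assms
proof (induction rule: orbit.induct)
  case base
  show ?case unfolding farey_eq by (intro exI conjI) auto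
next
  case (mirror C)
  then obtain p p' q q' where "\<bar>p * q' - p' * q\<bar> = 1" "C = farey_triangle \<beta> p p' q q'" by blast
  moreover have "q * p' - q' * p = - (p * q' - p' * q)" by simp
  ultimately show ?case by (metis farey_triangle_mirror abs_minus_cancel)
next
  case (turn C)
  then obtain p p' q q' where "\<bar>p * q' - p' * q\<bar> = 1" "C = farey_triangle \<beta> p p' q q'" by blast
  moreover have "q * (- p' - q') - q' * (- p - q) = p * q' - p' * q" by (simp add: algebra_simps)
  ultimately show ?case by (metis farey_triangle_turn)
next
  case (cross C)
  then obtain p p' q q' where "\<bar>p * q' - p' * q\<bar> = 1" "C = farey_triangle \<beta> p p' q q'" by blast
  moreover have "p * - q' - p' * - q = - (p * q' - p' * q)" by simp
  ultimately show ?case by (metis farey_triangle_cross abs_minus_cancel)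
qed

lemma fraction_form_in_orbit_values_cone:
  assumes "coprime i j" "farey_triangle \<beta> p p' q q' \<in> orbit C0"
  shows "fraction_form \<beta> (int i * p + int j * q) (int i * p' + int j * q') \<in> orbit_values C0"
  using assms
proof (induction "i + j" arbitrary: i j p p' q q' rule: less_induct)
  case less
  have vertices: "{fraction_form \<beta> p p', fraction_form \<beta> q q'} \<subseteq> orbit_values C0"
    using vertex_values_subset_orbit_values[OF less.prems(2)] by (simp add: farey_triangle_def)
  consider (left_zero) "i = 0" | (right_zero) "j = 0"
    | (subtract_right) "0 < j" "j \<le> i" | (subtract_left) "0 < i" "i \<le> j"
    by linarith
  then show ?case
  proof cases
    case left_zero
    then show ?thesis using less.prems(1) vertices by simp
  next
    case right_zero
    then show ?thesis using less.prems(1) vertices by simp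
  next
    case subtract_right
    have "coprime (i - j) j"
      using less.prems(1) subtract_right by (simp add: coprime_iff_gcd_eq_1 gcd_diff1_nat)
    moreover have "farey_triangle \<beta> p p' (p + q) (p' + q') \<in> orbit C0"
      unfolding farey_triangle_left_child[symmetric] using less.prems(2) by (intro orbit.intros)
    ultimately have "fraction_form \<beta> (int (i - j) * p + int j * (p + q)) (int (i - j) * p' + int j * (p' + q'))
        \<in> orbit_values C0"
      using less.hyps[of "i - j" j] subtract_right by simp
    then show ?thesis using subtract_right by (simp add: algebra_simps of_nat_diff)
  next
    case subtract_left
    have "coprime i (j - i)"
      using less.prems(1) subtract_left by (metis coprime_commute coprime_iff_gcd_eq_1 gcd_diff1_nat)
    moreover have "farey_triangle \<beta> (p + q) (p' + q') q q' \<in> orbit C0"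
      unfolding farey_triangle_right_child[symmetric] using less.prems(2) by (intro orbit.intros)
    ultimately have "fraction_form \<beta> (int i * (p + q) + int (j - i) * q) (int i * (p' + q') + int (j - i) * q')
        \<in> orbit_values C0"
      using less.hyps[of i "j - i"] subtract_left by simp
    then show ?thesis using subtract_left by (simp add: algebra_simps of_nat_diff)
  qed
qed

lemma is_unit_det_imp_coprime:
  fixes a b c d :: "'a :: {algebraic_semidom, comm_ring_1}"
  assumes "is_unit (a * d - b * c)"
  shows "coprime a b" "coprime c d"
  by (rule coprimeI, meson assms dvd_diff dvd_mult dvd_mult2 dvd_trans)+

lemma orbit_values_farey: "orbit_values (farey \<beta>) = {fraction_form \<beta> x y | x y. coprime x y}"
proof (intro equalityI subsetI)
  fix v assume "v \<in> orbit_values (farey \<beta>)"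
  then obtain C where "C \<in> orbit (farey \<beta>)" "v \<in> vertex_values C"
    by (auto simp: orbit_values_def)
  then obtain p p' q q' where det: "\<bar>p * q' - p' * q\<bar> = 1"
    and v: "v \<in> vertex_values (farey_triangle \<beta> p p' q q')"
    using orbit_farey by blast
  have unit: "is_unit (p * q' - p' * q)" "is_unit ((p + q) * q' - (p' + q') * q)"
    using det by (simp_all add: algebra_simps)
  show "v \<in> {fraction_form \<beta> x y | x y. coprime x y}"
    using v is_unit_det_imp_coprime[OF unit(1)] is_unit_det_imp_coprime(1)[OF unit(2)]
    by (auto simp: farey_triangle_def)
next
  fix v assume "v \<in> {fraction_form \<beta> x y | x y. coprime x y}"
  then obtain x y where v: "v = fraction_form \<beta> x y" and "coprime x y" by blast
  then have coprime_abs: "coprime (nat \<bar>x\<bar>) (nat \<bar>y\<bar>)"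
    by (simp add: coprime_int_iff[symmetric])
  have "farey_triangle \<beta> 1 0 0 1 \<in> orbit (farey \<beta>)" "farey_triangle \<beta> 1 0 0 (- 1) \<in> orbit (farey \<beta>)"
    using orbit.base orbit.cross[OF orbit.base, of "farey \<beta>"] unfolding farey_eq farey_triangle_cross
    by simp_all
  from this[THEN fraction_form_in_orbit_values_cone[OF coprime_abs]]
  have "fraction_form \<beta> \<bar>x\<bar> \<bar>y\<bar> \<in> orbit_values (farey \<beta>)" "fraction_form \<beta> \<bar>x\<bar> (- \<bar>y\<bar>) \<in> orbit_values (farey \<beta>)"
    by simp_all
  moreover have "v = fraction_form \<beta> \<bar>x\<bar> \<bar>y\<bar> \<or> v = fraction_form \<beta> \<bar>x\<bar> (- \<bar>y\<bar>)"
    unfolding v by (auto simp: fraction_form_def abs_if algebra_simps)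
  ultimately show "v \<in> orbit_values (farey \<beta>)" by auto
qed

lemma orbit_values_farey_add_int: "orbit_values (farey (\<beta> + of_int n)) = orbit_values (farey \<beta>)"
proof -
  have subset: "orbit_values (farey (\<beta> + of_int n)) \<subseteq> orbit_values (farey \<beta>)" for \<beta> n
    unfolding orbit_values_farey
  proof clarify
    fix x y :: int assume "coprime x y"
    then have "coprime x (y - n * x)"
      using gcd_add_mult[of x "- n" y] by (simp add: coprime_iff_gcd_eq_1 add.commute)
    moreover have "fraction_form (\<beta> + of_int n) x y = fraction_form \<beta> x (y - n * x)"
      by (simp add: fraction_form_def algebra_simps)
    ultimately show "\<exists>x' y'. fraction_form (\<beta> + of_int n) x y = fraction_form \<beta> x' y' \<and> coprime x' y'"
      by blast
  qed
  show ?thesis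
    using subset[of \<beta> n] subset[of "\<beta> + of_int n" "- n"] by simp
qed

lemma ex_primitive_fraction_form_le:
  assumes "fraction_form \<beta> x y \<noteq> 0"
  shows "\<exists>x' y'. coprime x' y' \<and> fraction_form \<beta> x' y' \<noteq> 0 \<and> \<bar>fraction_form \<beta> x' y'\<bar> \<le> \<bar>fraction_form \<beta> x y\<bar>"
proof -
  define g where "g = gcd x y"
  have "x \<noteq> 0"
    using assms by (auto simp: fraction_form_def)
  then have "g \<noteq> 0"
    by (simp add: g_def)
  then obtain x' y' where xy: "x = g * x'" "y = g * y'" "coprime x' y'"
    using gcd_coprime_exists[of x y] unfolding g_def by (metis mult.commute)
  have "1 \<le> \<bar>real_of_int g\<bar>"
    using \<open>g \<noteq> 0\<close> by linarith
  then have "1 \<le> (real_of_int g)\<^sup>2"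
    by (simp add: abs_le_square_iff[of 1, simplified])
  then have "\<bar>fraction_form \<beta> x' y'\<bar> \<le> \<bar>fraction_form \<beta> x y\<bar>"
    unfolding xy fraction_form_mult abs_mult by (simp add: mult_le_cancel_right1)
  moreover have "fraction_form \<beta> x' y' \<noteq> 0"
    using assms unfolding xy fraction_form_mult by simp
  ultimately show ?thesis
    using xy(3) by blast
qed

lemma dist_int_le: "dist_int x \<le> \<bar>x - of_int n\<bar>"
  unfolding dist_int_def by (rule round_diff_minimal)

lemma dist_int_le_half: "dist_int x \<le> 1 / 2"
  using of_int_round_abs_le[of x] by (simp add: dist_int_def abs_minus_commute)

lemma one_le_abs_fraction_form:
  assumes "0 < b" "b \<le> x" and nonzero: "fraction_form (of_int a / of_int b) x y \<noteq> 0"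
  shows "1 \<le> \<bar>fraction_form (of_int a / of_int b) x y\<bar>"
proof -
  let ?f = "fraction_form (of_int a / of_int b) x y"
  have scaled: "?f * of_int b = of_int (x * (x * a - y * b))"
    using \<open>0 < b\<close> by (simp add: fraction_form_def field_simps)
  then have "x * (x * a - y * b) \<noteq> 0"
    using nonzero \<open>0 < b\<close> by (metis less_irrefl mult_eq_0_iff of_int_0 of_int_0_eq_iff)
  then have "1 \<le> \<bar>x * a - y * b\<bar>"
    by auto
  then have "b * 1 \<le> \<bar>x\<bar> * \<bar>x * a - y * b\<bar>"
    using assms by (intro mult_mono) auto
  then have "of_int b \<le> \<bar>?f * of_int b\<bar>"
    unfolding scaled abs_mult[symmetric]
    by (simp only: mult_1_right of_int_abs[symmetric] of_int_le_iff)
  then show ?thesis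
    using \<open>0 < b\<close> by (simp add: abs_mult)
qed

lemma Zval_le_fraction_form:
  assumes quotient: "quotient_of r = (a, b)" and "2 \<le> b"
    and nonzero: "fraction_form (of_int a / of_int b) x y \<noteq> 0"
  shows "Zval r \<le> \<bar>fraction_form (of_int a / of_int b) x y\<bar>"
proof -
  let ?f = "fraction_form (of_int a / of_int b)"
  have Zval_le: "Zval r \<le> of_int q * dist_int (of_int q * of_int a / of_int b)" if "0 < q" "q < b" for q
    using that by (simp add: Zval_def quotient)
  have pos: "Zval r \<le> \<bar>?f x y\<bar>" if "0 < x" and nonzero: "?f x y \<noteq> 0" for x y
  proof (cases "x < b")
    case True
    have "Zval r \<le> of_int x * dist_int (of_int x * of_int a / of_int b)"
      by (rule Zval_le[OF that(1) True])
    also have "\<dots> \<le> of_int x * \<bar>of_int x * of_int a / of_int b - of_int y\<bar>"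
      using that by (intro mult_left_mono dist_int_le) auto
    also have "\<dots> = \<bar>?f x y\<bar>"
      using that by (simp add: fraction_form_def abs_mult mult.commute)
    finally show ?thesis .
  next
    case False
    have "Zval r \<le> 1 / 2"
      using Zval_le[of 1] dist_int_le_half[of "of_int a / of_int b"] \<open>2 \<le> b\<close> by simp
    then show ?thesis
      using one_le_abs_fraction_form[OF _ _ nonzero] False \<open>2 \<le> b\<close> by simp
  qed
  have "x \<noteq> 0"
    using nonzero by (auto simp: fraction_form_def)
  then show ?thesis
    using pos[OF _ nonzero] pos[of "- x" "- y"] nonzero fraction_form_minus by (cases "0 < x") auto
qed

lemma ex_fraction_form_eq_Zval:
  assumes quotient: "quotient_of r = (a, b)" and "2 \<le> b"
  shows "\<exists>x y. fraction_form (of_int a / of_int b) x y \<noteq> 0 \<and> \<bar>fraction_form (of_int a / of_int b) x y\<bar> = Zval r"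
proof -
  let ?g = "\<lambda>q::int. of_int q * dist_int (of_int q * of_int a / of_int b)"
  have "1 \<in> {0<..<b}"
    using \<open>2 \<le> b\<close> by simp
  then have "Min (?g ` {0<..<b}) \<in> ?g ` {0<..<b}"
    by (intro Min_in) (blast intro: finite_imageI finite_greaterThanLessThan_int)+
  then have "Zval r \<in> ?g ` {0<..<b}"
    by (simp add: Zval_def quotient)
  then obtain q where q: "0 < q" "q < b" "Zval r = ?g q" by auto
  define y where "y = round (of_int q * of_int a / of_int b :: real)"
  have "\<bar>fraction_form (of_int a / of_int b) q y\<bar> = Zval r"
    using q by (simp add: fraction_form_def dist_int_def y_def abs_mult mult.commute)
  moreover have "fraction_form (of_int a / of_int b) q y \<noteq> 0"
  proof
    assume "fraction_form (of_int a / of_int b) q y = 0"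
    then have "real_of_int (a * q) = real_of_int (y * b)"
      using q \<open>2 \<le> b\<close> by (simp add: fraction_form_def field_simps)
    then have "a * q = y * b"
      by (simp only: of_int_eq_iff)
    then have "b dvd q"
      using quotient_of_coprime[OF quotient]
      by (metis coprime_commute coprime_dvd_mult_right_iff dvd_triv_right)
    then show False
      using q zdvd_not_zless by blast
  qed
  ultimately show ?thesis by blast
qed

lemma Zval_eq_least_abs:
  assumes "quotient_of r = (a, b)" "2 \<le> b"
  shows "Zval r = least_abs (orbit_values (farey (of_int a / of_int b)))"
proof -
  let ?f = "fraction_form (of_int a / of_int b)"
  obtain x y where xy: "coprime x y" "?f x y \<noteq> 0" "\<bar>?f x y\<bar> \<le> Zval r"
    using ex_fraction_form_eq_Zval[OF assms] ex_primitive_fraction_form_le by metis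
  have "least_abs (orbit_values (farey (of_int a / of_int b))) = Zval r"
  proof (rule least_abs_eqI)
    show "?f x y \<in> orbit_values (farey (of_int a / of_int b))"
      using xy(1) unfolding orbit_values_farey by blast
    show "\<bar>?f x y\<bar> = Zval r"
      using xy Zval_le_fraction_form[OF assms xy(2)] by simp
    show "abs_gap (Zval r) (orbit_values (farey (of_int a / of_int b)))"
      using Zval_le_fraction_form[OF assms] unfolding abs_gap_def orbit_values_farey by blast
  qed (rule xy(2))
  then show ?thesis by simp
qed

lemma of_rat_in_Ints_iff:
  assumes "quotient_of r = (a, b)"
  shows "(of_rat r :: real) \<in> \<int> \<longleftrightarrow> b = 1"
proof
  have r: "of_rat r = (of_int a / of_int b :: real)"
    using quotient_of_div[OF assms] by (simp add: of_rat_divide)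
  assume "(of_rat r :: real) \<in> \<int>"
  then obtain k where "r = of_int k"
    by (metis Ints_cases of_rat_of_int_eq of_rat_eq_iff)
  then show "b = 1"
    using assms by simp
next
  assume "b = 1"
  then show "(of_rat r :: real) \<in> \<int>"
    using quotient_of_div[OF assms] by simp
qed

lemma Z_spectrum_eq: "Z_spectrum = {least_abs (orbit_values (farey \<alpha>)) | \<alpha>. \<alpha> \<in> \<rat> \<and> \<alpha> \<notin> \<int>}"
proof -
  have denom: "2 \<le> snd (quotient_of r) \<longleftrightarrow> (of_rat r :: real) \<notin> \<int>"
    and Zval: "2 \<le> snd (quotient_of r) \<Longrightarrow> Zval r = least_abs (orbit_values (farey (of_rat r)))" for r
  proof -
    obtain a b where quotient: "quotient_of r = (a, b)" by (cases "quotient_of r")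
    have "0 < b"
      by (rule quotient_of_denom_pos[OF quotient])
    then show "2 \<le> snd (quotient_of r) \<longleftrightarrow> (of_rat r :: real) \<notin> \<int>"
      using of_rat_in_Ints_iff[OF quotient] quotient by auto
    show "Zval r = least_abs (orbit_values (farey (of_rat r)))" if "2 \<le> snd (quotient_of r)"
      using Zval_eq_least_abs[OF quotient] that quotient quotient_of_div[OF quotient]
      by (simp add: of_rat_divide)
  qed
  have "Z_spectrum = {least_abs (orbit_values (farey (of_rat r))) | r. of_rat r \<notin> (\<int> :: real set)}"
    unfolding Z_spectrum_def using denom Zval by metis
  also have "\<dots> = {least_abs (orbit_values (farey \<alpha>)) | \<alpha>. \<alpha> \<in> \<rat> \<and> \<alpha> \<notin> \<int>}"
    by (auto elim: Rats_cases)
  finally show ?thesis .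
qed

section \<open>Strips of triangles\<close>

text \<open>
  A geodesic that never crosses edges of determinant \<open>c\<close> runs through a strip of triangles
  \<open>v\<^sub>i v\<^sub>i\<^sub>+\<^sub>1 v\<^sub>i\<^sub>+\<^sub>2\<close>: the determinants of \<open>v\<^sub>i v\<^sub>i\<^sub>+\<^sub>1\<close> alternate between \<open>\<sigma>\<close> and \<open>\<tau>\<close>, those of
  \<open>v\<^sub>i v\<^sub>i\<^sub>+\<^sub>2\<close> equal \<open>c\<close>.  The vertices are \<open>v\<^sub>i = (abscissa i, ordinate i)\<close> in coordinates with
  \<open>v\<^sub>0 = (1, 0)\<close> and \<open>v\<^sub>1 = (0, \<sigma>)\<close>, and \<open>det i j\<close> is the determinant of \<open>v\<^sub>i\<close> and \<open>v\<^sub>j\<close>.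
\<close>

locale markoff_strip =
  fixes \<sigma> \<tau> c :: real
  assumes triple: "real_markoff_triple \<sigma> \<tau> c" and \<sigma>_le: "\<sigma> \<le> c" and \<tau>_le: "\<tau> \<le> c"
begin

lemma dets_ge_1: "1 \<le> \<sigma>" "1 \<le> \<tau>" "1 \<le> c"
  using real_markoff_triple_ge_1[OF triple] by auto

lemma dets_pos [simp]: "0 < \<sigma>" "0 < \<tau>" "0 < c"
  and dets_nonneg [simp]: "0 \<le> \<sigma>" "0 \<le> \<tau>" "0 \<le> c"
  and dets_nonzero [simp]: "\<sigma> \<noteq> 0" "\<tau> \<noteq> 0" "c \<noteq> 0"
  using dets_ge_1 by auto

lemma c_le_mult_\<sigma>: "c \<le> c * \<sigma>"
  using dets_ge_1 by (simp add: mult_le_cancel_left1)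

definition side :: "nat \<Rightarrow> real" where
  "side i = (if even i then \<sigma> else \<tau>)"

lemma side_simps [simp]: "side 0 = \<sigma>" "side (Suc 0) = \<tau>" "side (Suc (Suc i)) = side i"
  by (auto simp: side_def)

lemma side_ge_1: "1 \<le> side i"
  and side_le: "side i \<le> c"
  using dets_ge_1 \<sigma>_le \<tau>_le by (auto simp: side_def)

lemma side_pos [simp]: "0 < side i"
  and side_nonzero [simp]: "side i \<noteq> 0"
  using side_ge_1[of i] by auto

lemma triple_sides: "real_markoff_triple (side i) (side (Suc i)) c"
  using triple real_markoff_triple_swap[OF triple] by (auto simp: side_def)

definition strip_linear :: "(nat \<Rightarrow> real) \<Rightarrow> bool" where
  "strip_linear f \<longleftrightarrow> (\<forall>i. side i * f (Suc (Suc i)) = side (Suc i) * f i + c * f (Suc i))"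

lemma strip_linearD: "strip_linear f \<Longrightarrow> side i * f (Suc (Suc i)) = side (Suc i) * f i + c * f (Suc i)"
  by (simp add: strip_linear_def)

lemma strip_linear_scale: "strip_linear f \<Longrightarrow> strip_linear (\<lambda>i. k * f i)"
  by (simp add: strip_linear_def algebra_simps)

lemma strip_linear_pos:
  assumes f: "strip_linear f" and "0 \<le> f i" "0 < f (Suc i)" "i < j"
  shows "0 < f j"
proof -
  have "0 \<le> f (i + n) \<and> 0 < f (Suc (i + n))" for n
  proof (induction n)
    case (Suc n)
    have "0 < side (i + n) * f (Suc (Suc (i + n)))"
      unfolding strip_linearD[OF f] using Suc.IH
      by (intro add_nonneg_pos mult_nonneg_nonneg mult_pos_pos) (auto simp: less_imp_le)
    then show ?case
      using Suc.IH side_pos[of "i + n"] by (simp add: zero_less_mult_iff)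
  qed (use assms in simp)
  from this[of "j - Suc i"] show ?thesis
    using \<open>i < j\<close> by simp
qed

lemma strip_linear_trace:
  assumes "strip_linear f"
  shows "f (i + 4) + f i = 3 * c * f (i + 2)"
proof -
  have steps: "side i * f (i + 2) = side (Suc i) * f i + c * f (i + 1)"
    "side (Suc i) * f (i + 3) = side i * f (i + 1) + c * f (i + 2)"
    "side i * f (i + 4) = side (Suc i) * f (i + 2) + c * f (i + 3)"
    using strip_linearD[OF assms, of i]
      strip_linearD[OF assms, of "Suc i"] strip_linearD[OF assms, of "Suc (Suc i)"]
    by (simp_all add: eval_nat_numeral)
  have "side i * side (Suc i) * (f (i + 4) + f i) = ((side i)\<^sup>2 + (side (Suc i))\<^sup>2 + c\<^sup>2) * f (i + 2)"
    using steps by algebra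
  also have "\<dots> = side i * side (Suc i) * (3 * c * f (i + 2))"
    unfolding real_markoff_triple_eq[OF triple_sides] by (simp add: mult_ac)
  finally show ?thesis
    using side_pos[of i] side_pos[of "Suc i"] by simp
qed

fun abscissa :: "nat \<Rightarrow> real" where
  "abscissa 0 = 1"
| "abscissa (Suc 0) = 0"
| "abscissa (Suc (Suc i)) = (side (Suc i) * abscissa i + c * abscissa (Suc i)) / side i"

fun ordinate :: "nat \<Rightarrow> real" where
  "ordinate 0 = 0"
| "ordinate (Suc 0) = \<sigma>"
| "ordinate (Suc (Suc i)) = (side (Suc i) * ordinate i + c * ordinate (Suc i)) / side i"

lemma strip_linear_abscissa: "strip_linear abscissa"
  and strip_linear_ordinate: "strip_linear ordinate"
  by (simp_all add: strip_linear_def)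

declare abscissa.simps(3) [simp del] ordinate.simps(3) [simp del]

lemma coordinates_Rats: "abscissa i \<in> \<rat>" "ordinate i \<in> \<rat>"
proof -
  have "\<sigma> \<in> \<rat>" "\<tau> \<in> \<rat>" "c \<in> \<rat>"
    using triple Ints_subset_Rats by (auto simp: real_markoff_triple_def)
  then have "side i \<in> \<rat>" for i
    by (simp add: side_def)
  with \<open>\<sigma> \<in> \<rat>\<close> \<open>c \<in> \<rat>\<close> show "abscissa i \<in> \<rat>" "ordinate i \<in> \<rat>"
    by (induction i rule: induct_nat_012) (simp_all add: abscissa.simps(3) ordinate.simps(3))
qed

lemma abscissa_2 [simp]: "abscissa (Suc (Suc 0)) = \<tau> / \<sigma>"
  and ordinate_2 [simp]: "ordinate (Suc (Suc 0)) = c"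
  by (simp_all add: abscissa.simps(3) ordinate.simps(3))

lemma ordinate_3: "ordinate (Suc (Suc (Suc 0))) = 3 * (c * \<sigma>) - \<tau>"
proof -
  have "\<tau> * ordinate (Suc (Suc (Suc 0))) = \<sigma>\<^sup>2 + c\<^sup>2"
    using strip_linearD[OF strip_linear_ordinate, of "Suc 0"] by (simp add: power2_eq_square)
  also have "\<dots> = \<tau> * (3 * (c * \<sigma>) - \<tau>)"
    using real_markoff_triple_eq[OF triple] by (simp add: algebra_simps power2_eq_square)
  finally show ?thesis
    unfolding mult_left_cancel[OF dets_nonzero(2)] .
qed

definition det :: "nat \<Rightarrow> nat \<Rightarrow> real" where
  "det i j = abscissa i * ordinate j - ordinate i * abscissa j"

lemma det_0 [simp]: "det 0 j = ordinate j"
  by (cases j rule: abscissa.cases) (simp_all add: det_def)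

lemma det_same [simp]: "det i i = 0"
  by (simp add: det_def)

lemma det_swap: "det j i = - det i j"
  by (simp add: det_def)

lemma det_ptolemy: "det i k * det j l = det i j * det k l + det i l * det j k"
  by (simp add: det_def algebra_simps)

lemma strip_linear_det: "strip_linear (det i)"
  unfolding strip_linear_def det_def
proof
  fix j
  show "side j * (abscissa i * ordinate (Suc (Suc j)) - ordinate i * abscissa (Suc (Suc j))) =
      side (Suc j) * (abscissa i * ordinate j - ordinate i * abscissa j) +
      c * (abscissa i * ordinate (Suc j) - ordinate i * abscissa (Suc j))"
    using strip_linearD[OF strip_linear_abscissa, of j] strip_linearD[OF strip_linear_ordinate, of j]
    by algebra
qed

lemma strip_linear_det_left: "strip_linear (\<lambda>i. det i j)"
  using strip_linear_scale[OF strip_linear_det, of "-1" j] by (simp add: det_swap[of _ j])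

lemma det_Suc: "det i (Suc i) = (- 1) ^ i * side i"
proof (induction i)
  case (Suc i)
  have "side i * det (Suc i) (Suc (Suc i)) = - side (Suc i) * det i (Suc i)"
    using strip_linearD[OF strip_linear_det] by (simp add: det_swap[of "Suc i" i])
  also have "\<dots> = side i * ((- 1) ^ Suc i * side (Suc i))"
    by (simp add: Suc.IH)
  finally show ?case
    unfolding mult_left_cancel[OF side_nonzero] .
qed simp

lemma det_Suc_Suc: "det i (Suc (Suc i)) = (- 1) ^ i * c"
proof -
  have "side i * det i (Suc (Suc i)) = side i * ((- 1) ^ i * c)"
    using strip_linearD[OF strip_linear_det, of i i] by (simp add: det_Suc)
  then show ?thesis
    unfolding mult_left_cancel[OF side_nonzero] .
qed

lemma det_sign:
  assumes "i < j"
  shows "0 < (- 1) ^ i * det i j"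
proof (rule strip_linear_pos[OF strip_linear_scale[OF strip_linear_det] _ _ assms])
  show "0 < (- 1) ^ i * det i (Suc i)"
    by (simp add: det_Suc side_pos power_mult_distrib[symmetric])
qed simp

lemma abs_det: "i < j \<Longrightarrow> \<bar>det i j\<bar> = (- 1) ^ i * det i j"
  using det_sign[of i j] by (cases "even i") auto

text \<open>The translation \<open>v\<^sub>i \<mapsto> v\<^sub>i\<^sub>+\<^sub>2\<close> preserves determinants.\<close>

lemma det_2_Suc_Suc: "det 2 (Suc (Suc i)) = ordinate i"
proof (induction i rule: induct_nat_012)
  case 1
  show ?case using det_Suc[of 2] by (simp add: eval_nat_numeral)
next
  case (ge2 i)
  have "side i * det 2 (Suc (Suc (Suc (Suc i)))) = side i * ordinate (Suc (Suc i))"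
    using strip_linearD[OF strip_linear_det, of "Suc (Suc i)" 2]
      strip_linearD[OF strip_linear_ordinate, of i] ge2
    by simp
  then show ?case
    using side_pos[of i] by simp
qed (simp add: eval_nat_numeral)

lemma ordinate_pos: "0 < i \<Longrightarrow> 0 < ordinate i"
  using det_sign[of 0 i] by simp

lemma ordinate_nonneg: "0 \<le> ordinate i"
  using ordinate_pos[of i] by (cases i) auto

lemma ordinate_growth: "2 * c * ordinate i \<le> ordinate (Suc (Suc i))"
proof (induction i rule: induct_nat_012)
  case 0
  show ?case using dets_ge_1 by simp
next
  case 1
  have "2 * (c * \<sigma>) \<le> 3 * (c * \<sigma>) - \<tau>"
    using \<tau>_le c_le_mult_\<sigma> by linarith
  then show ?case by (simp add: ordinate_3 mult.assoc)
next
  case (ge2 i)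
  have "1 * ordinate i \<le> 2 * c * ordinate i" "1 * ordinate (Suc (Suc i)) \<le> c * ordinate (Suc (Suc i))"
    using dets_ge_1(3) ordinate_nonneg by (intro mult_right_mono; simp)+
  then show ?case
    using ge2(1) strip_linear_trace[OF strip_linear_ordinate, of i] by (simp add: eval_nat_numeral)
qed

lemma ordinate_ge: "real i \<le> 2 * ordinate i"
proof (induction i rule: induct_nat_012)
  case 1
  show ?case using dets_ge_1 by simp
next
  case (ge2 i)
  have "1 \<le> ordinate (Suc (Suc i)) - ordinate i"
  proof (cases "i \<le> 1")
    case True
    then consider (zero) "i = 0" | (one) "i = 1" by linarith
    then show ?thesis
    proof cases
      case zero
      then show ?thesis using dets_ge_1 by simp
    next
      case one
      have "1 \<le> 3 * (c * \<sigma>) - \<tau> - \<sigma>"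
        using \<sigma>_le \<tau>_le c_le_mult_\<sigma> dets_ge_1 by linarith
      then show ?thesis using one by (simp add: ordinate_3)
    qed
  next
    case False
    then have "1 \<le> ordinate i"
      using ge2(1) by simp
    then have "1 * ordinate i \<le> c * ordinate i"
      using dets_ge_1 by (intro mult_right_mono) auto
    then show ?thesis
      using ordinate_growth[of i] \<open>1 \<le> ordinate i\<close> by linarith
  qed
  then show ?case using ge2(1) by simp
qed simp

lemma ordinate_defect: "\<bar>ordinate (Suc (Suc i)) - rho c * ordinate i\<bar> \<le> c"
proof (induction i rule: induct_nat_012)
  case 0
  show ?case using dets_ge_1 by simp
next
  case 1
  have "ordinate (Suc (Suc (Suc 0))) - rho c * \<sigma> = \<sigma> / rho c - \<tau>"
    unfolding ordinate_3 mult.assoc[symmetric] rho_add_inverse[OF dets_ge_1(3), symmetric]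
    by (simp add: algebra_simps)
  moreover have "0 \<le> \<sigma> / rho c" "\<sigma> / rho c \<le> \<sigma>"
    using dets_ge_1 rho_gt_1[OF dets_ge_1(3)] by (simp_all add: divide_le_eq mult_le_cancel_left1)
  ultimately show ?case
    using \<sigma>_le \<tau>_le dets_ge_1 by (simp add: eval_nat_numeral abs_le_iff)
next
  case (ge2 i)
  have rho: "1 < rho c" "3 * c = rho c + 1 / rho c"
    using rho_gt_1 rho_add_inverse dets_ge_1(3) by auto
  have "ordinate (Suc (Suc (Suc (Suc i)))) = 3 * c * ordinate (Suc (Suc i)) - ordinate i"
    using strip_linear_trace[OF strip_linear_ordinate, of i] by (simp add: eval_nat_numeral)
  then have "ordinate (Suc (Suc (Suc (Suc i)))) - rho c * ordinate (Suc (Suc i)) =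
      (ordinate (Suc (Suc i)) - rho c * ordinate i) / rho c"
    unfolding rho(2) using rho(1) by (simp add: field_simps)
  then have "\<bar>ordinate (Suc (Suc (Suc (Suc i)))) - rho c * ordinate (Suc (Suc i))\<bar> =
      \<bar>ordinate (Suc (Suc i)) - rho c * ordinate i\<bar> / rho c"
    using rho(1) by simp
  also have "\<dots> \<le> \<bar>ordinate (Suc (Suc i)) - rho c * ordinate i\<bar>"
    using rho(1) by (simp add: divide_le_eq mult_le_cancel_left1)
  finally show ?case
    using ge2(1) by linarith
qed

lemma ordinate_ratio_tendsto: "(\<lambda>i. ordinate i / ordinate (Suc (Suc i))) \<longlonglongrightarrow> 1 / rho c"
proof -
  have rho: "1 < rho c"
    by (rule rho_gt_1[OF dets_ge_1(3)])
  have bound: "norm (ordinate i / ordinate (Suc (Suc i)) - 1 / rho c) \<le> 2 * c / real (Suc (Suc i))" for i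
  proof -
    have pos: "0 < ordinate (Suc (Suc i))"
      by (rule ordinate_pos) simp
    have "ordinate i / ordinate (Suc (Suc i)) - 1 / rho c =
        - (ordinate (Suc (Suc i)) - rho c * ordinate i) / (rho c * ordinate (Suc (Suc i)))"
      using pos rho by (simp add: field_simps)
    then have "\<bar>ordinate i / ordinate (Suc (Suc i)) - 1 / rho c\<bar> =
        \<bar>ordinate (Suc (Suc i)) - rho c * ordinate i\<bar> / (rho c * ordinate (Suc (Suc i)))"
      using pos rho by (simp add: abs_mult abs_minus_commute)
    also have "\<dots> \<le> c / (1 * (real (Suc (Suc i)) / 2))"
      using ordinate_defect[of i] ordinate_ge[of "Suc (Suc i)"] rho dets_ge_1
      by (intro frac_le mult_mono) auto
    finally show ?thesis by (simp add: mult.commute)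
  qed
  have "(\<lambda>i. 2 * c / real (Suc (Suc i))) \<longlonglongrightarrow> 0"
    using LIMSEQ_Suc[OF LIMSEQ_Suc[OF lim_const_over_n[of "2 * c"]]] .
  then have "(\<lambda>i. ordinate i / ordinate (Suc (Suc i)) - 1 / rho c) \<longlonglongrightarrow> 0"
    by (rule Lim_null_comparison[OF always_eventually[OF allI[OF bound]]])
  then show ?thesis
    by (rule LIM_zero_cancel)
qed

lemma slope_tendsto: "(\<lambda>i. abscissa i / ordinate i) \<longlonglongrightarrow> (\<tau> / \<sigma> - 1 / rho c) / c"
proof -
  have slope: "abscissa (Suc (Suc i)) / ordinate (Suc (Suc i)) =
      (\<tau> / \<sigma> - ordinate i / ordinate (Suc (Suc i))) / c" for i
  proof -
    have "\<tau> / \<sigma> * ordinate (Suc (Suc i)) - c * abscissa (Suc (Suc i)) = ordinate i"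
      using det_2_Suc_Suc[of i] by (simp add: det_def eval_nat_numeral)
    moreover have "0 < ordinate (Suc (Suc i))"
      by (rule ordinate_pos) simp
    ultimately show ?thesis
      using dets_ge_1 by (simp add: field_simps)
  qed
  have "(\<lambda>i. abscissa (Suc (Suc i)) / ordinate (Suc (Suc i))) \<longlonglongrightarrow> (\<tau> / \<sigma> - 1 / rho c) / c"
    unfolding slope by (intro tendsto_intros ordinate_ratio_tendsto) simp
  then show ?thesis
    by (rule LIMSEQ_imp_Suc[OF LIMSEQ_imp_Suc])
qed

text \<open>For \<open>M < 3\<close> this is the junk value 0.\<close>

definition strip_constant :: "nat \<Rightarrow> real" where
  "strip_constant M = c * ordinate (M - 2) / ordinate M"

lemma strip_constant_tendsto: "strip_constant \<longlonglongrightarrow> c / rho c"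
proof -
  have "(\<lambda>i. c * (ordinate i / ordinate (Suc (Suc i)))) \<longlonglongrightarrow> c * (1 / rho c)"
    by (intro tendsto_intros ordinate_ratio_tendsto)
  then have "(\<lambda>i. strip_constant (Suc (Suc i))) \<longlonglongrightarrow> c / rho c"
    by (simp add: strip_constant_def)
  then show ?thesis
    by (rule LIMSEQ_imp_Suc[OF LIMSEQ_imp_Suc])
qed

definition form_at :: "real \<Rightarrow> real \<Rightarrow> real \<Rightarrow> nat \<Rightarrow> real" where
  "form_at A B C i = A * (abscissa i)\<^sup>2 + B * abscissa i * ordinate i + C * (ordinate i)\<^sup>2"

definition strip_triangle :: "real \<Rightarrow> real \<Rightarrow> real \<Rightarrow> nat \<Rightarrow> triangle" where
  "strip_triangle A B C i =
     Triangle (side (Suc i)) (form_at A B C i) c (form_at A B C (Suc i)) (side i) (form_at A B C (Suc (Suc i)))"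

lemma form_at_0 [simp]: "form_at A B C 0 = A"
  by (simp add: form_at_def)

lemma form_at_step:
  "form_at A B C (i + 3) =
    (c\<^sup>2 + (side i)\<^sup>2) * (form_at A B C (i + 1) + form_at A B C (i + 2)) / (side (Suc i))\<^sup>2 - form_at A B C i"
proof -
  have product: "(side (Suc i))\<^sup>2 * (f (i + 3) * g (i + 3) + f i * g i) =
      (c\<^sup>2 + (side i)\<^sup>2) * (f (i + 1) * g (i + 1) + f (i + 2) * g (i + 2))"
    if "strip_linear f" "strip_linear g" for f g
  proof -
    have "side i * h (i + 2) = side (Suc i) * h i + c * h (i + 1)"
      "side (Suc i) * h (i + 3) = side i * h (i + 1) + c * h (i + 2)" if "strip_linear h" for h
      using strip_linearD[OF that, of i] strip_linearD[OF that, of "Suc i"]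
      by (simp_all add: eval_nat_numeral)
    from this[OF that(1)] this[OF that(2)] show ?thesis by algebra
  qed
  have "(side (Suc i))\<^sup>2 * (form_at A B C (i + 3) + form_at A B C i) =
      (c\<^sup>2 + (side i)\<^sup>2) * (form_at A B C (i + 1) + form_at A B C (i + 2))"
    using product[OF strip_linear_abscissa strip_linear_abscissa]
      product[OF strip_linear_abscissa strip_linear_ordinate]
      product[OF strip_linear_ordinate strip_linear_ordinate]
    unfolding form_at_def by algebra
  then show ?thesis
    using side_pos[of "Suc i"] by (simp add: field_simps)
qed

lemma markoff_strip_triangle: "markoff (strip_triangle A B C i)"
  unfolding strip_triangle_def markoff.simps using triple_sides real_markoff_triple_rotate by blast

lemma cross_turn_strip_triangle: "cross (turn (strip_triangle A B C i)) = strip_triangle A B C (Suc i)"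
  using form_at_step[of A B C i] by (simp add: strip_triangle_def eval_nat_numeral)

lemma cross_strip_triangle_Suc: "cross (strip_triangle A B C (Suc i)) = turn (strip_triangle A B C i)"
  unfolding cross_turn_strip_triangle[symmetric]
  by (intro cross_cross markoff_turn markoff_strip_triangle)

lemma strip_triangle_in_orbit: "strip_triangle A B C i \<in> orbit (strip_triangle A B C 0)"
proof (induction i)
  case (Suc i)
  then show ?case
    unfolding cross_turn_strip_triangle[symmetric] by (intro orbit.intros)
qed (rule orbit.base)

lemma form_at_in_orbit_values: "form_at A B C i \<in> orbit_values (strip_triangle A B C 0)"
  using vertex_values_subset_orbit_values[OF strip_triangle_in_orbit, of A B C i]
  by (simp add: strip_triangle_def)

lemma unit_disc_strip_triangle_iff: "unit_disc (strip_triangle A B C 0) \<longleftrightarrow> B\<^sup>2 - 4 * A * C = 1"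
proof -
  have vertex_forms: "form_at A B C 1 = C * \<sigma>\<^sup>2"
    "\<sigma>\<^sup>2 * form_at A B C 2 = A * \<tau>\<^sup>2 + B * \<tau> * c * \<sigma> + C * c\<^sup>2 * \<sigma>\<^sup>2"
    by (simp_all add: form_at_def eval_nat_numeral field_simps)
  have "\<sigma>\<^sup>2 * form_at A B C 2 - \<tau>\<^sup>2 * form_at A B C 0 - c\<^sup>2 * form_at A B C 1 = B * (\<tau> * c * \<sigma>)"
    unfolding vertex_forms by (simp add: algebra_simps)
  then have "unit_disc (strip_triangle A B C 0) \<longleftrightarrow> (\<tau> * c * \<sigma>)\<^sup>2 * B\<^sup>2 = (\<tau> * c * \<sigma>)\<^sup>2 * (1 + 4 * A * C)"
    by (simp add: strip_triangle_def vertex_forms(1)[simplified] eval_nat_numeral algebra_simps power2_eq_square)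
  also have "\<dots> \<longleftrightarrow> B\<^sup>2 - 4 * A * C = 1"
    by auto
  finally show ?thesis .
qed

lemma unit_disc_strip_triangle: "B\<^sup>2 - 4 * A * C = 1 \<Longrightarrow> unit_disc (strip_triangle A B C i)"
  using orbit_unit_disc[OF strip_triangle_in_orbit markoff_strip_triangle] unit_disc_strip_triangle_iff
  by blast

lemma ex_strip_triangle: "\<exists>A B C. Triangle \<tau> P c Q \<sigma> R = strip_triangle A B C 0"
proof (intro exI)
  define B where "B = (R * \<sigma>\<^sup>2 - P * \<tau>\<^sup>2 - Q * c\<^sup>2) / (\<tau> * c * \<sigma>)"
  have "form_at P B (Q / \<sigma>\<^sup>2) 1 = Q" "form_at P B (Q / \<sigma>\<^sup>2) 2 = R"
    by (simp_all add: form_at_def B_def eval_nat_numeral field_simps)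
  then show "Triangle \<tau> P c Q \<sigma> R = strip_triangle P B (Q / \<sigma>\<^sup>2) 0"
    by (simp add: strip_triangle_def eval_nat_numeral)
qed

end

section \<open>Triangles away from the geodesic\<close>

text \<open>
  The edge \<open>pq\<close> separates the triangle from the geodesic, and the form has the sign \<open>\<epsilon>\<close> there.  This
  persists for all further triangles, and already the last inequality forces \<open>\<bar>R\<bar> \<ge> x y / s\<close>.
\<close>

fun beyond :: "real \<Rightarrow> triangle \<Rightarrow> bool" where
  "beyond \<epsilon> (Triangle x P y Q s R) \<longleftrightarrow>
     0 \<le> \<epsilon> * P \<and> 0 \<le> \<epsilon> * Q \<and> x * y * s \<le> \<epsilon> * (s\<^sup>2 * R - x\<^sup>2 * P - y\<^sup>2 * Q)"

definition outer :: "triangle \<Rightarrow> bool" where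
  "outer C \<longleftrightarrow> (\<exists>\<epsilon>\<in>{-1, 1}. beyond \<epsilon> C)"

lemma beyond_third_value:
  assumes triple: "real_markoff_triple x y s" and beyond: "beyond \<epsilon> (Triangle x P y Q s R)"
  shows "x * y / s \<le> \<epsilon> * R"
proof -
  have "0 \<le> x\<^sup>2 * (\<epsilon> * P)" "0 \<le> y\<^sup>2 * (\<epsilon> * Q)"
    using beyond by auto
  then have "s * (x * y) \<le> s * (s * (\<epsilon> * R))"
    using beyond by (simp add: algebra_simps power2_eq_square)
  then show ?thesis
    using real_markoff_triple_ge_1(3)[OF triple] by (simp add: divide_le_eq mult.commute)
qed

lemma outer_third_value:
  assumes triple: "real_markoff_triple x y s" and outer: "outer (Triangle x P y Q s R)"
  shows "det_product (Triangle x P y Q s R) / (max_det (Triangle x P y Q s R))\<^sup>2 \<le> \<bar>R\<bar>"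
proof -
  note ge_1 = real_markoff_triple_ge_1[OF triple]
  have "x * y * s / (max x (max y s))\<^sup>2 \<le> x * y * s / s\<^sup>2"
    using ge_1 by (intro divide_left_mono power_mono mult_nonneg_nonneg mult_pos_pos) auto
  also have "\<dots> = x * y / s"
    using ge_1 by (simp add: power2_eq_square)
  also have "\<dots> \<le> \<bar>R\<bar>"
    using outer beyond_third_value[OF triple] unfolding outer_def by fastforce
  finally show ?thesis by simp
qed

lemma beyond_cross_iff:
  assumes "s \<noteq> 0"
  shows "beyond \<epsilon> (cross (Triangle x P y Q s R)) \<longleftrightarrow>
    0 \<le> \<epsilon> * P \<and> 0 \<le> \<epsilon> * Q \<and> x * y * s \<le> \<epsilon> * (x\<^sup>2 * P + y\<^sup>2 * Q - s\<^sup>2 * R)"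
proof -
  have "s\<^sup>2 * ((x\<^sup>2 + y\<^sup>2) * (P + Q) / s\<^sup>2 - R) - y\<^sup>2 * P - x\<^sup>2 * Q = x\<^sup>2 * P + y\<^sup>2 * Q - s\<^sup>2 * R"
    using assms by (simp add: field_simps)
  then show ?thesis
    unfolding cross.simps beyond.simps by (simp add: mult.commute)
qed

lemma beyond_child:
  assumes "markoff C" "beyond \<epsilon> C"
  shows "beyond \<epsilon> (cross (turn C))" "beyond \<epsilon> (cross (turn (turn C)))"
proof -
  obtain x P y Q s R where C_eq: "C = Triangle x P y Q s R" by (cases C)
  then have triple: "real_markoff_triple x y s"
    using assms(1) by simp
  note ge_1 = real_markoff_triple_ge_1[OF triple]
  have "0 \<le> x * y / s"
    using ge_1 by simp
  then have "0 \<le> \<epsilon> * R"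
    using beyond_third_value[OF triple, of \<epsilon> P Q R] assms(2) C_eq by simp
  moreover have beyond: "0 \<le> \<epsilon> * P" "0 \<le> \<epsilon> * Q" "x * y * s \<le> \<epsilon> * (s\<^sup>2 * R - x\<^sup>2 * P - y\<^sup>2 * Q)"
    using assms(2) C_eq by auto
  moreover have "0 \<le> x\<^sup>2 * (\<epsilon> * P)" "0 \<le> y\<^sup>2 * (\<epsilon> * Q)"
    using beyond by auto
  moreover have "x \<noteq> 0" "y \<noteq> 0"
    using ge_1 by auto
  ultimately show "beyond \<epsilon> (cross (turn C))" "beyond \<epsilon> (cross (turn (turn C)))"
    unfolding C_eq turn.simps beyond_cross_iff[OF \<open>x \<noteq> 0\<close>] beyond_cross_iff[OF \<open>y \<noteq> 0\<close>]
    by (simp_all add: algebra_simps)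
qed

lemma outer_child:
  assumes "markoff C" "outer C"
  shows "outer (cross (turn C))" "outer (cross (turn (turn C)))"
  using beyond_child[OF assms(1)] assms(2) unfolding outer_def by blast+

lemma outer_cross_of_signs:
  assumes markoff: "markoff (Triangle x P y Q s R)" and disc: "unit_disc (Triangle x P y Q s R)"
    and signs: "P * R \<le> 0" "Q * R \<le> 0" "R \<noteq> 0"
  shows "outer (cross (Triangle x P y Q s R))"
proof -
  define \<epsilon> where "\<epsilon> = - sgn R"
  have \<epsilon>: "\<epsilon> \<in> {-1, 1}" "0 \<le> \<epsilon> * P" "0 \<le> \<epsilon> * Q" "\<epsilon> * R \<le> 0"
    using signs by (auto simp: \<epsilon>_def sgn_if mult_le_0_iff)
  have "s \<noteq> 0"
    using markoff real_markoff_triple_ge_1(3)[of x y s] by auto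
  have terms: "0 \<le> x\<^sup>2 * (\<epsilon> * P)" "0 \<le> y\<^sup>2 * (\<epsilon> * Q)" "s\<^sup>2 * (\<epsilon> * R) \<le> 0"
    using \<epsilon> by (auto simp: mult_nonneg_nonpos)
  have "(x * y * s)\<^sup>2 \<le> (x * y * s)\<^sup>2 + 4 * x\<^sup>2 * y\<^sup>2 * ((\<epsilon> * P) * (\<epsilon> * Q))"
    using \<epsilon>(2,3) by simp
  also have "\<dots> = (\<epsilon> * (x\<^sup>2 * P + y\<^sup>2 * Q - s\<^sup>2 * R))\<^sup>2"
  proof -
    have "\<epsilon>\<^sup>2 = 1"
      using \<epsilon>(1) by auto
    with disc show ?thesis
      unfolding unit_disc.simps by algebra
  qed
  finally have "x * y * s \<le> \<epsilon> * (x\<^sup>2 * P + y\<^sup>2 * Q - s\<^sup>2 * R)"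
    by (rule power2_le_imp_le) (use terms in \<open>simp add: algebra_simps\<close>)
  then have "beyond \<epsilon> (cross (Triangle x P y Q s R))"
    using \<epsilon> beyond_cross_iff[OF \<open>s \<noteq> 0\<close>] by blast
  then show ?thesis
    using \<epsilon>(1) unfolding outer_def by blast
qed

text \<open>
  The only way back from an outer triangle leads to its parent, so the outgrowth of a core that can
  only be left into outer triangles is closed under \<open>cross\<close>.
\<close>

inductive_set outgrowth :: "triangle set \<Rightarrow> triangle set" for core where
  core: "C \<in> core \<Longrightarrow> D \<in> arrangements C \<Longrightarrow> D \<in> outgrowth core"
| grow: "C \<in> outgrowth core \<Longrightarrow> outer (cross C) \<Longrightarrow> D \<in> arrangements (cross C) \<Longrightarrow> D \<in> outgrowth core"

lemma outgrowth_arrangements: "D \<in> outgrowth core \<Longrightarrow> E \<in> arrangements D \<Longrightarrow> E \<in> outgrowth core"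
  by (erule outgrowth.cases) (blast intro: outgrowth.intros arrangements_trans)+

lemma outgrowth_turn: "D \<in> outgrowth core \<Longrightarrow> turn D \<in> outgrowth core"
  by (rule outgrowth_arrangements) (auto intro: arrangements_turn arrangements_self)

lemma outgrowth_cross_outer: "D \<in> outgrowth core \<Longrightarrow> outer (cross D) \<Longrightarrow> cross D \<in> outgrowth core"
  using outgrowth.grow arrangements_self by blast

lemma outgrowth_markoff:
  assumes "\<And>C. C \<in> core \<Longrightarrow> markoff C" "D \<in> outgrowth core"
  shows "markoff D"
  using assms(2) by induction (use assms(1) arrangements_invariants(4) markoff_cross in blast)+

lemma outgrowth_cross:
  assumes markoff: "\<And>C. C \<in> core \<Longrightarrow> markoff C"
    and exits: "\<And>C N. C \<in> core \<Longrightarrow> N \<in> neighbours C \<Longrightarrow> outer N \<or> (\<exists>D\<in>core. N \<in> arrangements D)"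
    and D: "D \<in> outgrowth core"
  shows "cross D \<in> outgrowth core"
  using D
proof cases
  case (core C)
  then have "C \<in> outgrowth core"
    using outgrowth.core arrangements_self by blast
  then have "N \<in> outgrowth core" if "N \<in> neighbours C" "outer N" for N
    using that outgrowth_cross_outer outgrowth_turn by (auto simp: neighbours_def)
  moreover have "N \<in> outgrowth core" if "N \<in> neighbours C" "\<not> outer N" for N
    using exits[OF core(1)] that outgrowth.core by blast
  ultimately show ?thesis
    using cross_arrangements[OF core(2)] outgrowth_arrangements by blast
next
  case (grow C)
  have "markoff C"
    using grow(1) outgrowth_markoff markoff by blast
  then have "cross (cross C) = C" "markoff (cross C)"
    by (simp_all add: cross_cross markoff_cross)
  moreover have "cross C \<in> outgrowth core"
    using grow outgrowth_cross_outer by blast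
  ultimately have "N \<in> outgrowth core" if "N \<in> neighbours (cross C)" for N
    using that grow(1,2) outer_child outgrowth_cross_outer outgrowth_turn by (auto simp: neighbours_def)
  then show ?thesis
    using cross_arrangements[OF grow(3)] outgrowth_arrangements by blast
qed

definition gap_triangle :: "real \<Rightarrow> real \<Rightarrow> real \<Rightarrow> triangle \<Rightarrow> bool" where
  "gap_triangle \<mu> k c C \<longleftrightarrow> markoff C \<and> det_product C = k \<and> max_det C = c \<and> abs_gap \<mu> (vertex_values C)"

lemma gap_triangle_arrangements: "gap_triangle \<mu> k c C \<Longrightarrow> D \<in> arrangements C \<Longrightarrow> gap_triangle \<mu> k c D"
  unfolding gap_triangle_def using arrangements_invariants by metis

lemma gap_triangle_cross:
  assumes gap: "gap_triangle \<mu> k c C" and outer: "outer (cross C)" and "\<mu> \<le> k / c\<^sup>2"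
  shows "gap_triangle \<mu> k c (cross C)"
proof -
  obtain x P y Q s R where C_eq: "C = Triangle x P y Q s R" by (cases C)
  obtain R' where cross_eq: "cross C = Triangle y P x Q s R'"
    unfolding C_eq by simp
  have invariants: "markoff (cross C)" "det_product (cross C) = k" "max_det (cross C) = c"
    using gap markoff_cross by (auto simp: gap_triangle_def)
  have "k / c\<^sup>2 \<le> \<bar>R'\<bar>"
    using outer_third_value[of y x s P Q R'] outer invariants unfolding cross_eq by simp
  moreover have "abs_gap \<mu> {P, Q}"
    using gap by (simp add: C_eq gap_triangle_def abs_gap_def)
  ultimately have "abs_gap \<mu> (vertex_values (cross C))"
    using \<open>\<mu> \<le> k / c\<^sup>2\<close> by (simp add: cross_eq abs_gap_def)
  then show ?thesis
    using invariants by (simp add: gap_triangle_def)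
qed

lemma abs_gap_orbit_values:
  assumes core: "\<And>C. C \<in> core \<Longrightarrow> gap_triangle \<mu> k c C" and \<mu>: "\<mu> \<le> k / c\<^sup>2"
    and exits: "\<And>C N. C \<in> core \<Longrightarrow> N \<in> neighbours C \<Longrightarrow> outer N \<or> (\<exists>D\<in>core. N \<in> arrangements D)"
    and "C0 \<in> core"
  shows "abs_gap \<mu> (orbit_values C0)"
proof -
  have in_outgrowth: "C \<in> outgrowth core" if "C \<in> orbit C0" for C
    using that
  proof induction
    case base
    show ?case using \<open>C0 \<in> core\<close> outgrowth.core arrangements_self by blast
  next
    case (mirror C)
    then show ?case using outgrowth_arrangements arrangements_mirror arrangements_self by blast
  next
    case (turn C)
    then show ?case by (intro outgrowth_turn)
  next
    case (cross C)
    then show ?case using outgrowth_cross[of core] core exits by (auto simp: gap_triangle_def)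
  qed
  have "gap_triangle \<mu> k c C" if "C \<in> outgrowth core" for C
    using that
  proof induction
    case (core C D)
    then show ?case using assms(1) gap_triangle_arrangements by blast
  next
    case (grow C D)
    then show ?case using gap_triangle_cross \<mu> gap_triangle_arrangements by blast
  qed
  then show ?thesis
    using in_outgrowth unfolding orbit_values_def abs_gap_def gap_triangle_def by blast
qed

section \<open>The constant of a strip\<close>

context markoff_strip
begin

lemma ordinate_eq_det_2: "2 \<le> M \<Longrightarrow> ordinate (M - 2) = det 2 M"
  using det_2_Suc_Suc[of "M - 2"] by (simp add: Suc_diff_Suc numeral_2_eq_2)

lemma det_2_nonneg:
  assumes "0 < i"
  shows "0 \<le> det 2 i"
proof -
  consider (one) "i = 1" | (two) "i = 2" | (greater) "2 < i"
    using assms by linarith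
  then show ?thesis
  proof cases
    case one
    then show ?thesis using det_swap[of 2 1] det_Suc[of 1] by (simp add: numeral_2_eq_2)
  qed (use det_sign[of 2 i] in auto)
qed

lemma det_add_2_sign:
  assumes "i < M"
  shows "0 \<le> (- 1) ^ i * det (i + 2) M"
proof -
  consider (last) "M = Suc i" | (second_last) "M = i + 2" | (interior) "i + 2 < M"
    using assms by linarith
  then show ?thesis
  proof cases
    case last
    then show ?thesis
      using det_swap[of "i + 2" M] det_Suc[of M] by (simp add: power_add[symmetric] less_imp_le)
  qed (use det_sign[of "i + 2" M] in auto)
qed

text \<open>The value at \<open>v\<^sub>2\<close> is the smallest one: Ptolemy's relation for \<open>v\<^sub>2\<close>, \<open>v\<^sub>i\<close>, \<open>v\<^sub>i\<^sub>+\<^sub>2\<close>, \<open>v\<^sub>M\<close>.\<close>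

lemma ordinate_mult_det_ge:
  assumes "0 < i" "i < M" "2 \<le> M"
  shows "c * ordinate (M - 2) \<le> ordinate i * \<bar>det i M\<bar>"
proof -
  have "ordinate i * det i M = det 2 i * det (i + 2) M + det 2 M * det i (i + 2)"
    using det_ptolemy[of 2 "i + 2" i M] det_2_Suc_Suc[of i] by simp
  then have "ordinate i * ((- 1) ^ i * det i M) =
      det 2 i * ((- 1) ^ i * det (i + 2) M) + c * det 2 M * ((- 1) ^ i * (- 1) ^ i)"
    using det_Suc_Suc[of i] by (simp add: algebra_simps)
  moreover have "(- 1) ^ i * (- 1) ^ i = (1 :: real)"
    by (simp add: power_mult_distrib[symmetric])
  ultimately show ?thesis
    using det_2_nonneg[of i] det_add_2_sign[of i M] assms abs_det[of i M] ordinate_eq_det_2[of M]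
    by simp
qed

lemma strip_constant_le:
  assumes "2 \<le> M"
  shows "strip_constant M \<le> \<sigma> * \<tau> * c / c\<^sup>2"
proof -
  have "\<tau> * ordinate M = \<sigma> * ordinate (M - 2) + c * \<bar>det 1 M\<bar>"
    using strip_linearD[OF strip_linear_det_left, of 0 M] abs_det[of 1 M] assms ordinate_eq_det_2[of M]
    by (simp add: numeral_2_eq_2)
  then have "\<sigma> * \<tau> * ordinate M = \<sigma>\<^sup>2 * ordinate (M - 2) + c * (ordinate 1 * \<bar>det 1 M\<bar>)"
    by (simp add: algebra_simps power2_eq_square)
  also have "\<dots> \<ge> 0 + c * (c * ordinate (M - 2))"
    using ordinate_mult_det_ge[of 1 M] assms ordinate_nonneg
    by (intro add_mono mult_left_mono) (auto simp: less_imp_le)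
  finally have "c * (c * ordinate (M - 2)) \<le> \<sigma> * \<tau> * ordinate M" by simp
  then show ?thesis
    using ordinate_pos[of M] assms by (simp add: strip_constant_def field_simps power2_eq_square)
qed

lemma strip_constant_lt_1:
  assumes "2 \<le> M"
  shows "strip_constant M < 1"
proof -
  have "2 * c * ordinate (M - 2) \<le> ordinate M"
    using ordinate_growth[of "M - 2"] assms by (simp add: Suc_diff_Suc numeral_2_eq_2)
  moreover have "0 < ordinate M" "0 \<le> c * ordinate (M - 2)"
    using ordinate_pos[of M] ordinate_nonneg assms by auto
  ultimately show ?thesis
    by (simp add: strip_constant_def)
qed

lemma strip_constant_gt_third:
  assumes "5 \<le> M"
  shows "1 / 3 < strip_constant M"
proof -
  obtain i where M: "M = i + 4" "0 < i"
    using assms by (intro that[of "M - 4"]) auto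
  have "ordinate M + ordinate i = 3 * c * ordinate (M - 2)"
    using strip_linear_trace[OF strip_linear_ordinate, of i] by (simp add: M)
  then have "ordinate M < 3 * (c * ordinate (M - 2))"
    using ordinate_pos[OF M(2)] by simp
  then show ?thesis
    using ordinate_pos[of M] M by (simp add: strip_constant_def field_simps)
qed

lemma strip_constant_Rats: "strip_constant M \<in> \<rat>"
  using triple Ints_subset_Rats coordinates_Rats
  by (auto simp: strip_constant_def real_markoff_triple_def)

context
  fixes B C :: real and M :: nat
  assumes B: "B\<^sup>2 = 1" and M: "3 \<le> M" and zero: "form_at 0 B C M = 0"
begin

lemma form_at_eq_det: "form_at 0 B C i = B * (ordinate i * det i M / ordinate M)"
proof -
  have "ordinate M \<noteq> 0"
    using ordinate_pos[of M] M by simp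
  have "ordinate M * (B * abscissa M + C * ordinate M) = 0"
    using zero by (simp add: form_at_def power2_eq_square algebra_simps)
  then have "C * ordinate M = - B * abscissa M"
    using \<open>ordinate M \<noteq> 0\<close> by simp
  then have "ordinate M * form_at 0 B C i = B * (ordinate i * det i M)"
    unfolding form_at_def det_def by algebra
  then show ?thesis
    using \<open>ordinate M \<noteq> 0\<close> by (simp add: field_simps)
qed

lemma abs_form_at: "\<bar>form_at 0 B C i\<bar> = ordinate i * \<bar>det i M\<bar> / ordinate M"
proof -
  have "\<bar>B\<bar> = 1"
    using B by (auto simp: power2_eq_1_iff)
  then show ?thesis
    unfolding form_at_eq_det abs_mult using ordinate_nonneg by (simp add: abs_mult)
qed

lemma form_at_nonzero:
  assumes "0 < i" "i < M"
  shows "form_at 0 B C i \<noteq> 0"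
proof -
  have "0 < \<bar>form_at 0 B C i\<bar>"
    unfolding abs_form_at using ordinate_pos[of i] ordinate_pos[of M] det_sign[of i M] abs_det[of i M] assms
    by simp
  then show ?thesis by simp
qed

lemma form_at_adjacent:
  assumes "i < M"
  shows "form_at 0 B C i * form_at 0 B C (Suc i) \<le> 0"
proof -
  have "0 \<le> (- 1) ^ Suc i * det (Suc i) M"
    using det_sign[of "Suc i" M] assms by (cases "Suc i = M") auto
  then have "0 \<le> ((- 1) ^ i * det i M) * ((- 1) ^ Suc i * det (Suc i) M)"
    by (rule mult_nonneg_nonneg[OF less_imp_le[OF det_sign[OF assms]]])
  then have "det i M * det (Suc i) M \<le> 0"
    by (cases "even i") auto
  moreover have "0 \<le> B\<^sup>2 * ordinate i * ordinate (Suc i) / (ordinate M)\<^sup>2"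
    using ordinate_nonneg by simp
  ultimately have "(B\<^sup>2 * ordinate i * ordinate (Suc i) / (ordinate M)\<^sup>2) * (det i M * det (Suc i) M) \<le> 0"
    by (rule mult_nonneg_nonpos[rotated])
  then show ?thesis
    unfolding form_at_eq_det by (simp add: power2_eq_square mult_ac)
qed

lemma abs_form_at_2: "\<bar>form_at 0 B C 2\<bar> = strip_constant M"
  unfolding abs_form_at strip_constant_def using ordinate_eq_det_2[of M] ordinate_nonneg[of "M - 2"] M
  by (simp add: numeral_2_eq_2)

lemma strip_constant_le_form_at:
  assumes "0 < i" "i < M"
  shows "strip_constant M \<le> \<bar>form_at 0 B C i\<bar>"
  unfolding abs_form_at strip_constant_def
  using ordinate_mult_det_ge[OF assms] ordinate_nonneg M by (intro divide_right_mono) auto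

lemma abs_gap_strip_triangle:
  assumes "i + 2 \<le> M"
  shows "abs_gap (strip_constant M) (vertex_values (strip_triangle 0 B C i))"
proof -
  have "strip_constant M \<le> \<bar>form_at 0 B C j\<bar>" if "form_at 0 B C j \<noteq> 0" "j \<le> M" for j
  proof -
    have "j \<noteq> 0" "j \<noteq> M"
      using that(1) zero by (auto intro: Nat.gr0I)
    then show ?thesis
      using that strip_constant_le_form_at by simp
  qed
  then show ?thesis
    using assms by (auto simp: abs_gap_def strip_triangle_def)
qed

lemma unit_disc_isotropic_strip_triangle: "unit_disc (strip_triangle 0 B C i)"
  using unit_disc_strip_triangle B by simp

lemma outer_cross_first: "outer (cross (strip_triangle 0 B C 0))"
  using unit_disc_isotropic_strip_triangle[of 0]
    markoff_strip_triangle[of 0 B C 0] form_at_nonzero[of 2]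
    form_at_adjacent[of 1] M
  unfolding strip_triangle_def by (intro outer_cross_of_signs) (simp_all add: numeral_2_eq_2)

lemma outer_cross_turn_last:
  assumes "M = Suc (Suc i)"
  shows "outer (cross (turn (strip_triangle 0 B C i)))"
  using unit_disc_turn[OF unit_disc_isotropic_strip_triangle[of i]]
    markoff_turn[OF markoff_strip_triangle[of 0 B C i]]
    form_at_nonzero[of i] form_at_adjacent[of i] zero M assms
  unfolding strip_triangle_def turn.simps by (intro outer_cross_of_signs) (simp_all add: mult.commute)

lemma outer_cross_turn_turn:
  assumes "i + 2 \<le> M"
  shows "outer (cross (turn (turn (strip_triangle 0 B C i))))"
  using unit_disc_turn[OF unit_disc_turn[OF unit_disc_isotropic_strip_triangle[of i]]]
    markoff_turn[OF markoff_turn[OF markoff_strip_triangle[of 0 B C i]]]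
    form_at_nonzero[of "Suc i"] form_at_adjacent[of i] form_at_adjacent[of "Suc i"] assms
  unfolding strip_triangle_def turn.simps by (intro outer_cross_of_signs) (simp_all add: mult.commute)

lemma strip_triangle_exits:
  assumes "i + 2 \<le> M" and T: "T = strip_triangle 0 B C i"
    and N: "N \<in> neighbours T"
  shows "outer N \<or> (\<exists>j. j + 2 \<le> M \<and> N \<in> arrangements (strip_triangle 0 B C j))"
proof -
  consider (backward) "N = cross T" | (forward) "N = cross (turn T)"
    | (sideways) "N = cross (turn (turn T))"
    using N by (auto simp: neighbours_def)
  then show ?thesis
  proof cases
    case backward
    show ?thesis
    proof (cases i)
      case 0
      then show ?thesis using backward T outer_cross_first by simp
    next
      case (Suc j)
      then have "N \<in> arrangements (strip_triangle 0 B C j)"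
        unfolding backward T by (simp add: cross_strip_triangle_Suc arrangements_turn arrangements_self)
      then show ?thesis using Suc assms(1) by (intro disjI2 exI[of _ j]) simp
    qed
  next
    case forward
    show ?thesis
    proof (cases "i + 3 \<le> M")
      case True
      then show ?thesis
        unfolding forward T cross_turn_strip_triangle using arrangements_self
        by (intro disjI2 exI[of _ "Suc i"]) auto
    next
      case False
      then have "M = Suc (Suc i)"
        using assms(1) by simp
      then show ?thesis using forward T outer_cross_turn_last by simp
    qed
  next
    case sideways
    then show ?thesis using T assms(1) outer_cross_turn_turn by simp
  qed
qed

lemma least_abs_strip: "least_abs (orbit_values (strip_triangle 0 B C 0)) = strip_constant M"
proof (rule least_abs_eqI)
  define core where "core = {strip_triangle 0 B C i | i. i + 2 \<le> M}"
  show "form_at 0 B C 2 \<in> orbit_values (strip_triangle 0 B C 0)"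
    by (rule form_at_in_orbit_values)
  show "form_at 0 B C 2 \<noteq> 0"
    using form_at_nonzero[of 2] M by simp
  show "\<bar>form_at 0 B C 2\<bar> = strip_constant M"
    by (rule abs_form_at_2)
  show "abs_gap (strip_constant M) (orbit_values (strip_triangle 0 B C 0))"
  proof (rule abs_gap_orbit_values[of core _ "\<sigma> * \<tau> * c" c])
    fix T assume "T \<in> core"
    then obtain i where i: "T = strip_triangle 0 B C i" "i + 2 \<le> M"
      by (auto simp: core_def)
    have "det_product T = \<sigma> * \<tau> * c" "max_det T = c"
      using orbit_det_product[OF strip_triangle_in_orbit]
        orbit_max_det[OF strip_triangle_in_orbit] \<sigma>_le \<tau>_le
      unfolding i(1) by (auto simp: strip_triangle_def mult_ac max_def)
    then show "gap_triangle (strip_constant M) (\<sigma> * \<tau> * c) c T"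
      using i abs_gap_strip_triangle markoff_strip_triangle by (simp add: gap_triangle_def)
    show "outer N \<or> (\<exists>D\<in>core. N \<in> arrangements D)" if "N \<in> neighbours T" for N
      using strip_triangle_exits[OF i(2,1) that] unfolding core_def by blast
  next
    show "strip_constant M \<le> \<sigma> * \<tau> * c / c\<^sup>2"
      using strip_constant_le M by simp
    show "strip_triangle 0 B C 0 \<in> core"
      using M by (auto simp: core_def)
  qed
qed

end

end

section \<open>Strip constants belong to the spectrum\<close>

definition rational_split :: "triangle \<Rightarrow> bool" where
  "rational_split C \<longleftrightarrow> markoff C \<and> unit_disc C \<and> vertex_values C \<subseteq> \<rat>"

lemma rational_split_orbit: "D \<in> orbit C \<Longrightarrow> rational_split C \<Longrightarrow> rational_split D"
  unfolding rational_split_def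
  using orbit_markoff orbit_unit_disc orbit_values_Rats vertex_values_subset_orbit_values
  by (metis subset_trans)

lemma rational_split_flip: "rational_split C \<Longrightarrow> rational_split (flip C)"
  unfolding rational_split_def using markoff_flip unit_disc_flip vertex_values_flip_Rats by blast

lemma arrangements_in_orbit: "C \<in> arrangements D \<Longrightarrow> C \<in> orbit D"
  using orbit_arrangements orbit.base by blast

lemma ex_arrangement_longest_third:
  "\<exists>x P y Q s R. Triangle x P y Q s R \<in> arrangements C \<and> x \<le> s \<and> y \<le> s"
proof -
  obtain x P y Q s R where C_eq: "C = Triangle x P y Q s R" by (cases C)
  consider (third) "x \<le> s" "y \<le> s" | (second) "x \<le> y" "s \<le> y" | (first) "s \<le> x" "y \<le> x" by linarith
  then show ?thesis
  proof cases
    case third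
    then show ?thesis using C_eq arrangements_self by blast
  next
    case second
    moreover have "Triangle s R x P y Q \<in> arrangements C"
      using C_eq by (simp add: arrangements_def)
    ultimately show ?thesis by blast
  next
    case first
    moreover have "Triangle y Q s R x P \<in> arrangements C"
      using C_eq by (simp add: arrangements_def)
    ultimately show ?thesis by blast
  qed
qed

lemma flip_reduces_det_product:
  assumes triple: "real_markoff_triple x y s" and "x \<le> s" "y \<le> s" "s \<noteq> 1"
  shows "nat \<lfloor>det_product (flip (Triangle x P y Q s R))\<rfloor> < nat \<lfloor>det_product (Triangle x P y Q s R)\<rfloor>"
proof -
  let ?t = "3 * x * y - s"
  have triple': "real_markoff_triple x y ?t"
    by (rule real_markoff_triple_flip[OF triple])
  have "x * y * ?t < x * y * s"
    using real_markoff_triple_descent[OF assms] real_markoff_triple_ge_1[OF triple] by simp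
  moreover have "0 < x * y * ?t"
    using real_markoff_triple_ge_1[OF triple'] by simp
  moreover have "x * y * s \<in> \<int>" "x * y * ?t \<in> \<int>"
    using triple triple' unfolding real_markoff_triple_def by (meson Ints_mult)+
  ultimately show ?thesis
    unfolding flip_markoff_triple[OF triple]
    by (auto elim!: Ints_cases simp del: of_int_mult of_int_diff)
qed

lemma reduce_to_unit_dets:
  assumes "rational_split C"
  shows "\<exists>P Q R. rational_split (Triangle 1 P 1 Q 1 R) \<and> orbit_values (Triangle 1 P 1 Q 1 R) = orbit_values C"
  using assms
proof (induction "nat \<lfloor>det_product C\<rfloor>" arbitrary: C rule: less_induct)
  case less
  obtain x P y Q s R where D: "Triangle x P y Q s R \<in> arrangements C" "x \<le> s" "y \<le> s"
    using ex_arrangement_longest_third by blast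
  let ?D = "Triangle x P y Q s R"
  have orbit: "?D \<in> orbit C"
    by (rule arrangements_in_orbit[OF D(1)])
  have split: "rational_split ?D"
    by (rule rational_split_orbit[OF orbit less.prems])
  have orbit_values_D: "orbit_values ?D = orbit_values C"
    using orbit_values_orbit[OF orbit] less.prems by (simp add: rational_split_def)
  have triple: "real_markoff_triple x y s"
    using split by (simp add: rational_split_def)
  show ?case
  proof (cases "s = 1")
    case True
    then have "x = 1" "y = 1"
      using real_markoff_triple_ge_1(1,2)[OF triple] D(2,3) by auto
    then show ?thesis
      using split orbit_values_D True by blast
  next
    case False
    have "nat \<lfloor>det_product (flip ?D)\<rfloor> < nat \<lfloor>det_product C\<rfloor>"
      using flip_reduces_det_product[OF triple D(2,3) False] orbit_det_product[OF orbit] by metis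
    moreover have "orbit_values (flip ?D) = orbit_values C"
      using orbit_values_flip split orbit_values_D unfolding rational_split_def by blast
    ultimately show ?thesis
      using less.hyps[of "flip ?D"] rational_split_flip[OF split] by simp
  qed
qed

lemma reduce_to_farey:
  assumes "rational_split C" "0 \<in> orbit_values C"
  shows "\<exists>\<alpha>\<in>\<rat>. orbit_values (farey \<alpha>) = orbit_values C"
proof -
  obtain A B D where unit_dets: "rational_split (Triangle 1 A 1 B 1 D)"
    "orbit_values (Triangle 1 A 1 B 1 D) = orbit_values C"
    using reduce_to_unit_dets[OF assms(1)] by blast
  then obtain T where T: "T \<in> orbit (Triangle 1 A 1 B 1 D)" "0 \<in> vertex_values T"
    using assms(2) unfolding orbit_values_def by blast
  obtain x P y Q s R where T_eq: "T = Triangle x P y Q s R" by (cases T)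
  have "max_det T = 1" "markoff T"
    using orbit_max_det[OF T(1)] orbit_markoff[OF T(1)] by simp_all
  then have ones: "x = 1" "y = 1" "s = 1"
    using real_markoff_triple_ge_1[of x y s] by (auto simp: T_eq)
  then obtain P' R' where arranged: "Triangle 1 P' 1 0 1 R' \<in> arrangements T"
    using T(2) unfolding T_eq ones by (auto simp: arrangements_def)
  then have "Triangle 1 R' 1 0 1 P' \<in> arrangements T"
    using arrangements_turn[OF arrangements_turn[OF arrangements_mirror[OF arranged]]] by simp
  have "(R' - P')\<^sup>2 = 1"
    using rational_split_orbit[OF orbit_arrangements[OF T(1) arranged] unit_dets(1)]
    by (simp add: rational_split_def)
  then have "R' = P' - 1 \<or> P' = R' - 1"
    by (auto simp: power2_eq_1_iff)
  then obtain \<alpha> where \<alpha>: "farey \<alpha> \<in> arrangements T"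
    using arranged \<open>Triangle 1 R' 1 0 1 P' \<in> arrangements T\<close> by blast
  then have orbit: "farey \<alpha> \<in> orbit (Triangle 1 A 1 B 1 D)"
    by (rule orbit_arrangements[OF T(1)])
  then have "\<alpha> \<in> \<rat>"
    using rational_split_orbit[OF orbit unit_dets(1)] by (simp add: rational_split_def)
  then show ?thesis
    using orbit_values_orbit[OF orbit] unit_dets(2) by auto
qed

lemma orbit_values_farey_Ints: "\<alpha> \<in> \<int> \<Longrightarrow> orbit_values (farey \<alpha>) \<subseteq> \<int>"
  unfolding orbit_values_farey by (auto simp: fraction_form_def)

context markoff_strip
begin

lemma strip_constant_in_Z_spectrum:
  assumes "3 \<le> M"
  shows "strip_constant M \<in> Z_spectrum"
proof -
  define C where "C = - (abscissa M / ordinate M)"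
  let ?U = "orbit_values (strip_triangle 0 1 C 0)"
  have zero: "form_at 0 1 C M = 0"
    using ordinate_pos[of M] assms by (simp add: form_at_def C_def power2_eq_square)
  have "C \<in> \<rat>"
    using coordinates_Rats by (simp add: C_def)
  then have "form_at 0 1 C i \<in> \<rat>" for i
    using coordinates_Rats by (simp add: form_at_def)
  then have "rational_split (strip_triangle 0 1 C 0)"
    using markoff_strip_triangle[of 0 1 C 0] unit_disc_strip_triangle[of 1 0 C 0]
    by (simp add: rational_split_def strip_triangle_def)
  moreover have "0 \<in> ?U"
    using form_at_in_orbit_values[of 0 1 C 0] by simp
  ultimately obtain \<alpha> where \<alpha>: "\<alpha> \<in> \<rat>" "orbit_values (farey \<alpha>) = ?U"
    using reduce_to_farey by blast
  have "\<alpha> \<notin> \<int>"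
  proof
    assume "\<alpha> \<in> \<int>"
    then have "form_at 0 1 C 2 \<in> \<int>"
      using orbit_values_farey_Ints form_at_in_orbit_values[of 0 1 C 2] \<alpha>(2) by blast
    then have "1 \<le> \<bar>form_at 0 1 C 2\<bar>"
      using form_at_nonzero[OF _ assms zero, of 2] assms by (intro Ints_nonzero_abs_ge1) auto
    then show False
      using abs_form_at_2[OF _ assms zero] strip_constant_lt_1[of M] assms by simp
  qed
  moreover have "least_abs (orbit_values (farey \<alpha>)) = strip_constant M"
    using least_abs_strip[OF _ assms zero] \<alpha>(2) by simp
  ultimately show ?thesis
    unfolding Z_spectrum_eq using \<alpha>(1) by (auto intro!: exI[of _ \<alpha>])
qed

lemma islimpt_Z_spectrum: "c / rho c islimpt Z_spectrum \<inter> {1/3<..}"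
proof -
  have "c \<in> \<int>"
    using triple by (simp add: real_markoff_triple_def)
  have "strip_constant (M + 5) \<noteq> c / rho c" for M
  proof
    assume eq: "strip_constant (M + 5) = c / rho c"
    have "c / strip_constant (M + 5) \<in> \<rat>"
      using strip_constant_Rats \<open>c \<in> \<int>\<close> Ints_subset_Rats by auto
    then show False
      using rho_irrational[OF \<open>c \<in> \<int>\<close> dets_ge_1(3)] unfolding eq by simp
  qed
  then have "strip_constant (M + 5) \<in> Z_spectrum \<inter> {1/3<..} - {c / rho c}" for M
    using strip_constant_in_Z_spectrum strip_constant_gt_third by simp
  moreover have "(\<lambda>M. strip_constant (M + 5)) \<longlonglongrightarrow> c / rho c"
    by (rule LIMSEQ_ignore_initial_segment[OF strip_constant_tendsto])
  ultimately show ?thesis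
    unfolding islimpt_sequential by (intro exI[of _ "\<lambda>M. strip_constant (M + 5)"]) simp
qed

end

section \<open>Following the geodesic\<close>

text \<open>The geodesic separates the vertex \<open>q\<close> opposite to the longest edge from the other two.\<close>

fun corner :: "triangle \<Rightarrow> bool" where
  "corner (Triangle x P y Q s R) \<longleftrightarrow>
     markoff_strip s x y \<and> unit_disc (Triangle x P y Q s R) \<and> P * Q < 0 \<and> Q * R < 0"

definition has_corner_above :: "real set \<Rightarrow> real \<Rightarrow> bool" where
  "has_corner_above U c \<longleftrightarrow> (\<exists>D. corner D \<and> orbit_values D = U \<and> c < max_det D)"

lemma quadratic_root_Rats:
  fixes A B C D x :: real
  assumes "A \<in> \<rat>" "B \<in> \<rat>" "C \<in> \<rat>" "D \<in> \<rat>" "D \<noteq> 0"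
    and disc: "B\<^sup>2 - 4 * A * C = D\<^sup>2" and root: "A * x\<^sup>2 + B * x + C = 0"
  shows "x \<in> \<rat>"
proof (cases "A = 0")
  case True
  then have "B \<noteq> 0" "B * x = - C"
    using disc root \<open>D \<noteq> 0\<close> by auto
  then have "x = - C / B"
    by (simp add: field_simps)
  then show ?thesis
    using assms(2,3) by simp
next
  case False
  have "(2 * A * x + B)\<^sup>2 = D\<^sup>2"
    using disc root by algebra
  then have "2 * A * x + B = D \<or> 2 * A * x + B = - D"
    by (simp add: power2_eq_iff)
  then have "x = (D - B) / (2 * A) \<or> x = (- D - B) / (2 * A)"
    using False by (auto simp: field_simps)
  then show ?thesis
    using assms(1,2,4) by auto
qed

context markoff_strip
begin

lemma coefficients_Rats:
  assumes "vertex_values (strip_triangle A B C 0) \<subseteq> \<rat>"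
  shows "A \<in> \<rat>" "B \<in> \<rat>" "C \<in> \<rat>"
proof -
  have "{form_at A B C 0, form_at A B C 1, form_at A B C 2} \<subseteq> \<rat>"
    using assms by (simp add: strip_triangle_def numeral_2_eq_2)
  then have vertices: "form_at A B C 0 \<in> \<rat>" "form_at A B C 1 \<in> \<rat>" "form_at A B C 2 \<in> \<rat>"
    by auto
  have dets: "\<sigma> \<in> \<rat>" "\<tau> \<in> \<rat>" "c \<in> \<rat>"
    using triple Ints_subset_Rats by (auto simp: real_markoff_triple_def)
  show A: "A \<in> \<rat>"
    using vertices(1) by simp
  have "C = form_at A B C 1 / \<sigma>\<^sup>2"
    by (simp add: form_at_def)
  then show C: "C \<in> \<rat>"
    using vertices(2) dets by (metis Rats_divide Rats_power)
  have "B = (\<sigma>\<^sup>2 * form_at A B C 2 - A * \<tau>\<^sup>2 - C * c\<^sup>2 * \<sigma>\<^sup>2) / (\<tau> * c * \<sigma>)"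
    by (simp add: form_at_def numeral_2_eq_2 field_simps)
  then show "B \<in> \<rat>"
    using vertices(3) A C dets by (metis Rats_divide Rats_diff Rats_mult Rats_power)
qed

text \<open>Perpetually alternating values force the limit slope, which is irrational, to be a root of the form.\<close>

lemma form_at_not_alternating:
  assumes "A \<in> \<rat>" "B \<in> \<rat>" "C \<in> \<rat>" "B\<^sup>2 - 4 * A * C = 1"
  shows "\<exists>i\<ge>k. 0 \<le> form_at A B C i * form_at A B C (Suc i)"
proof (rule ccontr)
  assume "\<not> ?thesis"
  then have alternating: "form_at A B C i * form_at A B C (Suc i) < 0" if "k \<le> i" for i
    using that by force
  define \<kappa> where "\<kappa> = (\<tau> / \<sigma> - 1 / rho c) / c"
  define g where "g i = A * (abscissa i / ordinate i)\<^sup>2 + B * (abscissa i / ordinate i) + C" for i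
  have g: "g i = form_at A B C i / (ordinate i)\<^sup>2" if "0 < i" for i
    using ordinate_pos[OF that] by (simp add: g_def form_at_def field_simps power2_eq_square)
  have "g \<longlonglongrightarrow> A * \<kappa>\<^sup>2 + B * \<kappa> + C"
    unfolding g_def \<kappa>_def by (intro tendsto_intros slope_tendsto)
  then have "(\<lambda>i. g i * g (Suc i)) \<longlonglongrightarrow> (A * \<kappa>\<^sup>2 + B * \<kappa> + C) * (A * \<kappa>\<^sup>2 + B * \<kappa> + C)"
    by (intro tendsto_mult LIMSEQ_Suc)
  moreover have "g i * g (Suc i) \<le> 0" if "Suc k \<le> i" for i
    using alternating[of i] that by (simp add: g divide_nonpos_nonneg less_imp_le)
  ultimately have "(A * \<kappa>\<^sup>2 + B * \<kappa> + C) * (A * \<kappa>\<^sup>2 + B * \<kappa> + C) \<le> 0"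
    by (intro LIMSEQ_le_const2) auto
  then have "A * \<kappa>\<^sup>2 + B * \<kappa> + C = 0"
    by (auto simp: mult_le_0_iff)
  then have "\<kappa> \<in> \<rat>"
    using quadratic_root_Rats[of A B C 1] assms by simp
  moreover have "\<sigma> \<in> \<rat>" "\<tau> \<in> \<rat>" "c \<in> \<int>" "c \<in> \<rat>"
    using triple Ints_subset_Rats by (auto simp: real_markoff_triple_def)
  ultimately have "1 / (\<tau> / \<sigma> - c * \<kappa>) \<in> \<rat>"
    by simp
  moreover have "1 / (\<tau> / \<sigma> - c * \<kappa>) = rho c"
    by (simp add: \<kappa>_def)
  ultimately show False
    using rho_irrational[OF \<open>c \<in> \<int>\<close> dets_ge_1(3)] by simp
qed

lemma turn_flip_strip_triangle:
  "turn (flip (turn (strip_triangle A B C n))) =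
    Triangle (side n) (form_at A B C (n + 3)) (3 * c * side n - side (Suc n)) (form_at A B C (n + 1))
      c (form_at A B C n)"
proof -
  have "real_markoff_triple c (side n) (side (Suc n))"
    using triple_sides real_markoff_triple_rotate real_markoff_triple_swap by blast
  then show ?thesis
    using form_at_step[of A B C n] real_markoff_triple_vieta_div by (simp add: strip_triangle_def)
qed

lemma orbit_values_turn_flip_strip_triangle:
  "orbit_values (turn (flip (turn (strip_triangle A B C n)))) = orbit_values (strip_triangle A B C 0)"
proof -
  let ?S = "turn (strip_triangle A B C n)"
  have "orbit_values (turn (flip ?S)) = orbit_values (flip ?S)"
    by (intro orbit_values_orbit orbit.intros markoff_flip markoff_turn markoff_strip_triangle)
  also have "\<dots> = orbit_values ?S"
    by (intro orbit_values_flip markoff_turn markoff_strip_triangle)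
  also have "\<dots> = orbit_values (strip_triangle A B C 0)"
    by (intro orbit_values_orbit orbit.turn strip_triangle_in_orbit markoff_strip_triangle)
  finally show ?thesis .
qed

lemma markoff_strip_flip: "markoff_strip c (side n) (3 * c * side n - side (Suc n))"
  and flipped_side_gt: "c < 3 * c * side n - side (Suc n)"
proof -
  have "real_markoff_triple c (side n) (side (Suc n))"
    using triple_sides real_markoff_triple_rotate real_markoff_triple_swap by blast
  then have "real_markoff_triple c (side n) (3 * c * side n - side (Suc n))"
    by (rule real_markoff_triple_flip)
  moreover have "3 * c * 1 \<le> 3 * c * side n"
    using side_ge_1 by (intro mult_left_mono) auto
  then show "c < 3 * c * side n - side (Suc n)"
    using side_le[of "Suc n"] dets_pos(3) by linarith
  ultimately show "markoff_strip c (side n) (3 * c * side n - side (Suc n))"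
    using side_le[of n] by unfold_locales linarith+
qed

text \<open>
  If the strip is left over an edge of determinant \<open>c\<close>, three consecutive crossed edges
  share a vertex, and flipping the middle one produces a corner of a larger Markoff triple.
\<close>

lemma has_corner_above_strip:
  assumes disc: "B\<^sup>2 - 4 * A * C = 1"
    and signs: "form_at A B C n * form_at A B C (n + 1) < 0"
      "form_at A B C (n + 1) * form_at A B C (n + 2) < 0"
      "0 < form_at A B C (n + 2) * form_at A B C (n + 3)"
  shows "has_corner_above (orbit_values (strip_triangle A B C 0)) c"
proof -
  define D where "D = turn (flip (turn (strip_triangle A B C n)))"
  note D_eq = D_def[unfolded turn_flip_strip_triangle]
  have "unit_disc D"
    unfolding D_def using disc
    by (intro unit_disc_turn unit_disc_flip markoff_turn markoff_strip_triangle unit_disc_strip_triangle)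
  moreover have "form_at A B C (n + 3) * form_at A B C (n + 1) < 0"
    "form_at A B C (n + 1) * form_at A B C n < 0"
    using signs by (auto simp: mult_less_0_iff zero_less_mult_iff)
  ultimately have "corner D"
    using markoff_strip_flip unfolding D_eq corner.simps by blast
  moreover have "c < max_det D"
    using flipped_side_gt[of n] by (simp add: D_eq)
  ultimately show ?thesis
    using orbit_values_turn_flip_strip_triangle unfolding D_def has_corner_above_def by blast
qed

lemma zero_or_larger_corner:
  assumes rat: "vertex_values (strip_triangle A B C 0) \<subseteq> \<rat>" and disc: "B\<^sup>2 - 4 * A * C = 1"
    and signs: "form_at A B C k * form_at A B C (k + 1) < 0"
      "form_at A B C (k + 1) * form_at A B C (k + 2) < 0"
  shows "has_corner_above (orbit_values (strip_triangle A B C 0)) c \<or>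
    (\<exists>n\<ge>k. form_at A B C n * form_at A B C (n + 1) < 0 \<and> form_at A B C (n + 1) * form_at A B C (n + 2) < 0 \<and>
      form_at A B C (n + 3) = 0)"
proof -
  let ?F = "form_at A B C"
  let ?nonneg = "\<lambda>i. k \<le> i \<and> 0 \<le> ?F i * ?F (Suc i)"
  obtain j where j: "k \<le> j" "0 \<le> ?F j * ?F (j + 1)" and least: "\<forall>i<j. \<not> ?nonneg i"
    using form_at_not_alternating[OF coefficients_Rats[OF rat] disc, of k] exists_least_iff[of ?nonneg]
    by auto
  have before: "?F i * ?F (i + 1) < 0" if "k \<le> i" "i < j" for i
    using least that by (auto simp: not_le)
  have "j \<noteq> k" "j \<noteq> k + 1"
    using j(2) signs by auto
  then obtain n where n: "k \<le> n" "j = n + 2"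
    using j(1) by (intro that[of "j - 2"]) auto
  have alternating: "?F n * ?F (n + 1) < 0" "?F (n + 1) * ?F (n + 2) < 0"
    using before[of n] before[of "n + 1"] n by (auto simp: numeral_2_eq_2)
  have "0 \<le> ?F (n + 2) * ?F (n + 3)"
    using j(2) n(2) by (simp add: numeral_3_eq_3)
  then consider (positive) "0 < ?F (n + 2) * ?F (n + 3)" | (zero) "?F (n + 3) = 0"
    using alternating(2) by (auto simp: less_le)
  then show ?thesis
  proof cases
    case positive
    then show ?thesis using has_corner_above_strip[OF disc alternating] by blast
  next
    case zero
    then show ?thesis using alternating n(1) by blast
  qed
qed

lemma strip_constant_or_larger_corner:
  assumes rat: "vertex_values (strip_triangle 0 B C 0) \<subseteq> \<rat>" and disc: "B\<^sup>2 = 1"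
    and signs: "form_at 0 B C 1 * form_at 0 B C 2 < 0" "form_at 0 B C 2 * form_at 0 B C 3 < 0"
  shows "has_corner_above (orbit_values (strip_triangle 0 B C 0)) c \<or>
    (\<exists>M. least_abs (orbit_values (strip_triangle 0 B C 0)) = strip_constant M)"
proof -
  have "B\<^sup>2 - 4 * 0 * C = 1"
    using disc by simp
  moreover have "form_at 0 B C 1 * form_at 0 B C (1 + 1) < 0"
    "form_at 0 B C (1 + 1) * form_at 0 B C (1 + 2) < 0"
    using signs by (simp_all add: numeral_2_eq_2 numeral_3_eq_3)
  ultimately consider (larger) "has_corner_above (orbit_values (strip_triangle 0 B C 0)) c"
    | (zero) n where "form_at 0 B C (n + 3) = 0"
    using zero_or_larger_corner[OF rat] by blast
  then show ?thesis
  proof cases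
    case zero
    then have "least_abs (orbit_values (strip_triangle 0 B C 0)) = strip_constant (n + 3)"
      by (intro least_abs_strip[OF disc]) auto
    then show ?thesis by blast
  qed blast
qed

lemma reversed_strip:
  assumes disc: "B\<^sup>2 - 4 * A * C = 1" and zero: "form_at A B C (n + 3) = 0"
  obtains B' C' where "B'\<^sup>2 = 1"
    "markoff_strip.strip_triangle (side n) (side (Suc n)) c 0 B' C' 0 =
      mirror (turn (strip_triangle A B C (Suc n)))"
    "markoff_strip.form_at (side n) (side (Suc n)) c 0 B' C' 1 = form_at A B C (n + 2)"
    "markoff_strip.form_at (side n) (side (Suc n)) c 0 B' C' 2 = form_at A B C (n + 1)"
    "markoff_strip.form_at (side n) (side (Suc n)) c 0 B' C' 3 = form_at A B C n"
proof -
  interpret reversed: markoff_strip "side n" "side (Suc n)" c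
    using triple_sides side_le by unfold_locales
  have "mirror (turn (strip_triangle A B C (Suc n))) =
      Triangle (side (Suc n)) 0 c (form_at A B C (n + 2)) (side n) (form_at A B C (n + 1))"
    using zero by (simp add: strip_triangle_def numeral_3_eq_3)
  moreover from reversed.ex_strip_triangle obtain A' B' C' where
    "Triangle (side (Suc n)) 0 c (form_at A B C (n + 2)) (side n) (form_at A B C (n + 1)) =
      reversed.strip_triangle A' B' C' 0"
    by blast
  ultimately have triangle: "reversed.strip_triangle A' B' C' 0 = mirror (turn (strip_triangle A B C (Suc n)))"
    and start: "A' = 0" "reversed.form_at A' B' C' 1 = form_at A B C (n + 2)"
      "reversed.form_at A' B' C' 2 = form_at A B C (n + 1)"
    by (simp_all add: reversed.strip_triangle_def numeral_2_eq_2)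
  have "unit_disc (reversed.strip_triangle A' B' C' 0)"
    unfolding triangle using disc by (intro unit_disc_mirror unit_disc_turn unit_disc_strip_triangle)
  then have "B'\<^sup>2 = 1"
    unfolding reversed.unit_disc_strip_triangle_iff start(1) by simp
  moreover have "reversed.form_at 0 B' C' 3 = form_at A B C n"
    using reversed.form_at_step[of A' B' C' 0] form_at_step[of A B C n] zero start
    by (simp add: numeral_2_eq_2 add.commute)
  ultimately show thesis
    using that triangle start by simp
qed

lemma strip_constant_or_larger_corner_of_zero:
  assumes rat: "orbit_values (strip_triangle A B C 0) \<subseteq> \<rat>" and disc: "B\<^sup>2 - 4 * A * C = 1"
    and signs: "form_at A B C n * form_at A B C (n + 1) < 0"
      "form_at A B C (n + 1) * form_at A B C (n + 2) < 0"
    and zero: "form_at A B C (n + 3) = 0"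
  shows "has_corner_above (orbit_values (strip_triangle A B C 0)) c \<or>
    (\<exists>M. least_abs (orbit_values (strip_triangle A B C 0)) =
      markoff_strip.strip_constant (side n) (side (Suc n)) c M)"
proof -
  interpret reversed: markoff_strip "side n" "side (Suc n)" c
    using triple_sides side_le by unfold_locales
  obtain B' C' where disc': "B'\<^sup>2 = 1"
    and triangle: "reversed.strip_triangle 0 B' C' 0 = mirror (turn (strip_triangle A B C (Suc n)))"
    and start: "reversed.form_at 0 B' C' 1 = form_at A B C (n + 2)"
      "reversed.form_at 0 B' C' 2 = form_at A B C (n + 1)"
      "reversed.form_at 0 B' C' 3 = form_at A B C n"
    using reversed_strip[OF disc zero] .
  have orbit: "reversed.strip_triangle 0 B' C' 0 \<in> orbit (strip_triangle A B C 0)"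
    unfolding triangle by (intro orbit.mirror orbit.turn strip_triangle_in_orbit)
  have "vertex_values (reversed.strip_triangle 0 B' C' 0) \<subseteq> \<rat>"
    using vertex_values_subset_orbit_values[OF orbit] rat by blast
  moreover have "reversed.form_at 0 B' C' 1 * reversed.form_at 0 B' C' 2 < 0"
    "reversed.form_at 0 B' C' 2 * reversed.form_at 0 B' C' 3 < 0"
    using signs unfolding start by (simp_all only: mult.commute)
  ultimately show ?thesis
    unfolding orbit_values_orbit[OF orbit markoff_strip_triangle, symmetric]
    by (intro reversed.strip_constant_or_larger_corner[OF _ disc'])
qed

end

lemma corner_dichotomy:
  assumes corner: "corner D" and rat: "orbit_values D \<subseteq> \<rat>"
  shows "has_corner_above (orbit_values D) (max_det D) \<or>
    (\<exists>\<sigma> \<tau> M. markoff_strip \<sigma> \<tau> (max_det D) \<and>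
      least_abs (orbit_values D) = markoff_strip.strip_constant \<sigma> \<tau> (max_det D) M)"
proof -
  obtain \<sigma> \<tau> c P Q R where D: "D = Triangle \<tau> P c Q \<sigma> R" by (cases D)
  then interpret markoff_strip \<sigma> \<tau> c
    using corner by simp
  have max_det: "max_det D = c"
    using D \<sigma>_le \<tau>_le by (simp add: max_def)
  obtain A B C where strip: "D = strip_triangle A B C 0"
    using ex_strip_triangle D by blast
  have "unit_disc D"
    using corner D by simp
  then have disc: "B\<^sup>2 - 4 * A * C = 1"
    unfolding strip unit_disc_strip_triangle_iff .
  have signs: "form_at A B C 0 * form_at A B C (0 + 1) < 0" "form_at A B C (0 + 1) * form_at A B C (0 + 2) < 0"
    using corner D strip by (auto simp: strip_triangle_def numeral_2_eq_2)
  have "vertex_values D \<subseteq> \<rat>"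
    using vertex_values_subset_orbit_values[OF orbit.base] rat by blast
  from zero_or_larger_corner[OF this[unfolded strip] disc signs]
  consider (larger) "has_corner_above (orbit_values D) c"
    | (zero) n where "form_at A B C n * form_at A B C (n + 1) < 0"
      "form_at A B C (n + 1) * form_at A B C (n + 2) < 0"
      "form_at A B C (n + 3) = 0"
    unfolding strip by blast
  then show ?thesis
  proof cases
    case larger
    then show ?thesis unfolding max_det by blast
  next
    case (zero n)
    moreover have "markoff_strip (side n) (side (Suc n)) c"
      using triple_sides side_le by unfold_locales
    ultimately show ?thesis
      using strip_constant_or_larger_corner_of_zero[OF rat[unfolded strip] disc zero]
      unfolding max_det strip[symmetric] by blast
  qed
qed

lemma (in markoff_strip) corner_inequality:
  assumes t: "0 \<le> t" "t \<le> p" "t \<le> q" "t \<le> r"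
    and disc: "(c\<^sup>2 * q + \<sigma>\<^sup>2 * r + \<tau>\<^sup>2 * p)\<^sup>2 = \<sigma>\<^sup>2 * \<tau>\<^sup>2 * (c\<^sup>2 + 4 * r * p)"
  shows "t\<^sup>2 * (9 * c\<^sup>2 - 4) \<le> c\<^sup>2"
proof -
  define a b where "a = r - t" and "b = p - t"
  have ab: "0 \<le> a" "0 \<le> b" "r = t + a" "p = t + b"
    using t by (auto simp: a_def b_def)
  define E where "E = 3 * \<sigma> * \<tau> * c * t + (\<sigma>\<^sup>2 * a + \<tau>\<^sup>2 * b)"
  have "0 \<le> E"
    using t(1) ab by (simp add: E_def)
  have "E = c\<^sup>2 * t + \<sigma>\<^sup>2 * r + \<tau>\<^sup>2 * p"
    unfolding E_def real_markoff_triple_eq[OF triple, symmetric] ab(3,4) by (simp add: algebra_simps)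
  also have "\<dots> \<le> c\<^sup>2 * q + \<sigma>\<^sup>2 * r + \<tau>\<^sup>2 * p"
    using t(3) by (simp add: mult_left_mono)
  finally have "E\<^sup>2 \<le> \<sigma>\<^sup>2 * \<tau>\<^sup>2 * (c\<^sup>2 + 4 * r * p)"
    unfolding disc[symmetric] using \<open>0 \<le> E\<close> by (rule power_mono)
  moreover have "E\<^sup>2 = \<sigma>\<^sup>2 * \<tau>\<^sup>2 * (t\<^sup>2 * (9 * c\<^sup>2 - 4) + 4 * r * p) +
      (2 * \<sigma> * \<tau> * t * (a * (\<sigma> * (3 * \<sigma> * c - 2 * \<tau>)) + b * (\<tau> * (3 * \<tau> * c - 2 * \<sigma>))) + (\<sigma>\<^sup>2 * a - \<tau>\<^sup>2 * b)\<^sup>2)"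
    unfolding E_def ab(3,4) by (simp add: algebra_simps power2_eq_square)
  moreover have "0 \<le> 2 * \<sigma> * \<tau> * t * (a * (\<sigma> * (3 * \<sigma> * c - 2 * \<tau>)) + b * (\<tau> * (3 * \<tau> * c - 2 * \<sigma>)))"
  proof -
    have "1 * c \<le> \<sigma> * c" "1 * c \<le> \<tau> * c"
      using dets_ge_1 by (intro mult_right_mono; simp)+
    then have "0 \<le> 3 * \<sigma> * c - 2 * \<tau>" "0 \<le> 3 * \<tau> * c - 2 * \<sigma>"
      using \<sigma>_le \<tau>_le dets_ge_1 by linarith+
    then show ?thesis
      using t(1) ab by simp
  qed
  ultimately have "\<sigma>\<^sup>2 * \<tau>\<^sup>2 * (t\<^sup>2 * (9 * c\<^sup>2 - 4) + 4 * r * p) \<le> \<sigma>\<^sup>2 * \<tau>\<^sup>2 * (c\<^sup>2 + 4 * r * p)"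
    using zero_le_power2[of "\<sigma>\<^sup>2 * a - \<tau>\<^sup>2 * b"] by linarith
  then show ?thesis
    by simp
qed

lemma corner_max_det_le:
  assumes corner: "corner D" and gap: "abs_gap t (orbit_values D)" and t: "1 / 3 < t"
  shows "max_det D \<le> 4 * t\<^sup>2 / (9 * t\<^sup>2 - 1)"
proof -
  obtain \<sigma> \<tau> c P Q R where D: "D = Triangle \<tau> P c Q \<sigma> R" by (cases D)
  then interpret markoff_strip \<sigma> \<tau> c
    using corner by simp
  have signs: "P * Q < 0" "Q * R < 0"
    using corner D by auto
  have "{P, Q, R} \<subseteq> orbit_values D"
    using vertex_values_subset_orbit_values[OF orbit.base, of D] D by simp
  then have abs_ge: "t \<le> \<bar>P\<bar>" "t \<le> \<bar>Q\<bar>" "t \<le> \<bar>R\<bar>"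
    using gap signs unfolding abs_gap_def by auto
  have "unit_disc (turn (turn D))"
    using corner by (intro unit_disc_turn) (simp add: D)
  then have "(c\<^sup>2 * Q - \<sigma>\<^sup>2 * R - \<tau>\<^sup>2 * P)\<^sup>2 = \<sigma>\<^sup>2 * \<tau>\<^sup>2 * (c\<^sup>2 + 4 * R * P)"
    by (simp add: D)
  moreover have "(c\<^sup>2 * \<bar>Q\<bar> + \<sigma>\<^sup>2 * \<bar>R\<bar> + \<tau>\<^sup>2 * \<bar>P\<bar>)\<^sup>2 = (c\<^sup>2 * Q - \<sigma>\<^sup>2 * R - \<tau>\<^sup>2 * P)\<^sup>2"
    and "\<bar>R\<bar> * \<bar>P\<bar> = R * P"
    using signs by (auto simp: abs_if mult_less_0_iff power2_eq_square algebra_simps)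
  ultimately have "(c\<^sup>2 * \<bar>Q\<bar> + \<sigma>\<^sup>2 * \<bar>R\<bar> + \<tau>\<^sup>2 * \<bar>P\<bar>)\<^sup>2 = \<sigma>\<^sup>2 * \<tau>\<^sup>2 * (c\<^sup>2 + 4 * \<bar>R\<bar> * \<bar>P\<bar>)"
    by (simp add: mult.assoc)
  then have "t\<^sup>2 * (9 * c\<^sup>2 - 4) \<le> c\<^sup>2"
    using corner_inequality[OF _ abs_ge] t by simp
  then have "c\<^sup>2 * (9 * t\<^sup>2 - 1) \<le> 4 * t\<^sup>2"
    by (simp add: algebra_simps)
  moreover have "0 < 9 * t\<^sup>2 - 1"
    using power_strict_mono[OF t, of 2] by (simp add: power2_eq_square)
  moreover from this have "c * (9 * t\<^sup>2 - 1) \<le> c\<^sup>2 * (9 * t\<^sup>2 - 1)"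
    using dets_ge_1(3) by (intro mult_right_mono) (auto simp: power2_eq_square)
  ultimately have "c \<le> 4 * t\<^sup>2 / (9 * t\<^sup>2 - 1)"
    using pos_le_divide_eq order.trans by blast
  then show ?thesis
    using D \<sigma>_le \<tau>_le by (simp add: max_def)
qed

lemma corner_imp_strip_constant:
  assumes corner: "corner C" and rat: "orbit_values C \<subseteq> \<rat>"
    and gap: "abs_gap t (orbit_values C)" and t: "1 / 3 < t"
  shows "\<exists>\<sigma> \<tau> c M. markoff_strip \<sigma> \<tau> c \<and> c \<le> 4 * t\<^sup>2 / (9 * t\<^sup>2 - 1) \<and>
    least_abs (orbit_values C) = markoff_strip.strip_constant \<sigma> \<tau> c M"
proof -
  define corners where "corners = {D. corner D \<and> orbit_values D = orbit_values C}"
  have bound: "max_det D \<le> 4 * t\<^sup>2 / (9 * t\<^sup>2 - 1)" if "D \<in> corners" for D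
    using that gap corner_max_det_le[OF _ _ t] by (simp add: corners_def)
  have "max_det D \<in> \<int> \<and> 1 \<le> max_det D" if "D \<in> corners" for D
    using that
    by (cases D) (auto simp: corners_def markoff_strip_def real_markoff_triple_def max_def)
  then have "max_det ` corners \<subseteq> {z \<in> \<int>. 1 \<le> z \<and> z \<le> 4 * t\<^sup>2 / (9 * t\<^sup>2 - 1)}"
    using bound by auto
  then have "finite (max_det ` corners)"
    using finite_Ints_atLeastAtMost by (rule finite_subset)
  moreover have "C \<in> corners"
    using corner by (simp add: corners_def)
  ultimately obtain D where D: "D \<in> corners" "\<And>E. E \<in> corners \<Longrightarrow> max_det E \<le> max_det D"
    using Max_in[of "max_det ` corners"] Max_ge[of "max_det ` corners"]
    by (metis empty_iff imageE imageI)
  then have "\<not> has_corner_above (orbit_values D) (max_det D)"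
    by (force simp: corners_def has_corner_above_def)
  then obtain \<sigma> \<tau> M where "markoff_strip \<sigma> \<tau> (max_det D)"
    "least_abs (orbit_values D) = markoff_strip.strip_constant \<sigma> \<tau> (max_det D) M"
    using corner_dichotomy[of D] D(1) rat by (auto simp: corners_def)
  then show ?thesis
    using bound[OF D(1)] D(1) by (auto simp: corners_def)
qed

lemma farey_corner:
  assumes "0 < \<beta>" "\<beta> < 1" "\<beta> \<noteq> 1 / 2"
  shows "\<exists>C. corner C \<and> orbit_values C = orbit_values (farey \<beta>)"
proof -
  have strip: "markoff_strip 1 1 1"
    by unfold_locales simp_all
  define D where "D = cross (turn (turn (farey \<beta>)))"
  have D: "D = Triangle 1 (\<beta> - 1) 1 \<beta> 1 (4 * \<beta> - 2)"
    by (simp add: D_def)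
  have "D \<in> orbit (farey \<beta>)"
    unfolding D_def by (intro orbit.intros)
  then have orbit: "D \<in> orbit (farey \<beta>)" "turn (turn D) \<in> orbit (farey \<beta>)"
    by (auto intro: orbit.turn)
  then have disc: "unit_disc D" "unit_disc (turn (turn D))"
    by (auto intro: orbit_unit_disc)
  consider (small) "\<beta> < 1 / 2" | (large) "1 / 2 < \<beta>"
    using assms(3) by linarith
  then show ?thesis
  proof cases
    case small
    then have "corner D"
      using assms strip disc(1) unfolding D turn.simps corner.simps
      by (simp add: mult_less_0_iff del: unit_disc.simps)
    then show ?thesis
      using orbit_values_orbit[OF orbit(1)] by auto
  next
    case large
    then have "corner (turn (turn D))"
      using assms strip disc(2) unfolding D turn.simps corner.simps
      by (simp add: mult_less_0_iff del: unit_disc.simps)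
    then show ?thesis
      using orbit_values_orbit[OF orbit(2)] by auto
  qed
qed

lemma least_abs_farey_half: "least_abs (orbit_values (farey (1 / 2))) = markoff_strip.strip_constant 1 1 1 3"
proof -
  interpret markoff_strip 1 1 1
    by unfold_locales simp_all
  have "strip_triangle 0 1 (- 1 / 2) 0 = turn (farey (1 / 2))"
    by (simp add: strip_triangle_def form_at_def)
  moreover have "form_at 0 1 (- 1 / 2) 3 = 0"
    by (simp add: form_at_def numeral_3_eq_3 abscissa.simps(3) ordinate.simps(3))
  moreover have "orbit_values (turn (farey (1 / 2))) = orbit_values (farey (1 / 2))"
    by (intro orbit_values_orbit orbit.intros) simp
  ultimately show ?thesis
    using least_abs_strip[of 1 3 "- 1 / 2"] by simp
qed

lemma Z_spectrum_imp_strip_constant: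
  assumes "z \<in> Z_spectrum" "t \<le> z" and t: "1 / 3 < t"
  shows "\<exists>\<sigma> \<tau> c M. markoff_strip \<sigma> \<tau> c \<and> c \<le> max 1 (4 * t\<^sup>2 / (9 * t\<^sup>2 - 1)) \<and>
    z = markoff_strip.strip_constant \<sigma> \<tau> c M"
proof -
  obtain \<alpha> where \<alpha>: "\<alpha> \<in> \<rat>" "\<alpha> \<notin> \<int>" and z_\<alpha>: "z = least_abs (orbit_values (farey \<alpha>))"
    using assms(1) unfolding Z_spectrum_eq by blast
  define \<beta> where "\<beta> = frac \<alpha>"
  have z: "z = least_abs (orbit_values (farey \<beta>))"
    using orbit_values_farey_add_int[of \<beta> "\<lfloor>\<alpha>\<rfloor>"] z_\<alpha> by (simp add: \<beta>_def frac_def)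
  have \<beta>: "0 < \<beta>" "\<beta> < 1" "\<beta> \<in> \<rat>"
    unfolding \<beta>_def using \<alpha> by (simp_all add: frac_gt_0_iff frac_lt_1)
  show ?thesis
  proof (cases "\<beta> = 1 / 2")
    case True
    moreover have "markoff_strip 1 1 1"
      by unfold_locales simp_all
    ultimately show ?thesis
      using z least_abs_farey_half by (metis max.cobounded1)
  next
    case False
    obtain C where C: "corner C" "orbit_values C = orbit_values (farey \<beta>)"
      using farey_corner[OF \<beta>(1,2) False] by blast
    have "orbit_values C \<subseteq> \<rat>"
      unfolding C(2) using \<beta>(3) by (intro orbit_values_Rats) auto
    moreover have "abs_gap t (orbit_values C)"
      using abs_gap_least_abs[of "orbit_values C"] z assms(2) unfolding abs_gap_def C(2) by force
    ultimately show ?thesis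
      using corner_imp_strip_constant[OF C(1) _ _ t] unfolding z C(2) by (metis max.coboundedI2)
  qed
qed

section \<open>Limit points\<close>

lemma finite_bounded_markoff_strips: "finite {(\<sigma>, \<tau>, c). markoff_strip \<sigma> \<tau> c \<and> c \<le> K}"
  using finite_bounded_real_markoff_triples[of K] by (simp add: markoff_strip_def conj_assoc)

lemma islimpt_Z_spectrum_imp:
  assumes x: "x islimpt Z_spectrum" "1 / 3 < x"
  shows "\<exists>\<sigma> \<tau> c. markoff_strip \<sigma> \<tau> c \<and> x = c / rho c"
proof -
  obtain t where t: "1 / 3 < t" "t < x"
    using dense[OF x(2)] by blast
  define T where "T = {(\<sigma>, \<tau>, c). markoff_strip \<sigma> \<tau> c \<and> c \<le> max 1 (4 * t\<^sup>2 / (9 * t\<^sup>2 - 1))}"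
  let ?constants = "\<lambda>(\<sigma>, \<tau>, c). range (markoff_strip.strip_constant \<sigma> \<tau> c)"
  have "x islimpt Z_spectrum \<inter> {t<..}"
  proof (rule islimpt_Int_eventually[OF x(1)])
    show "\<forall>\<^sub>F y in at x. y \<in> {t<..}"
      using t(2) by (intro eventually_at_in_open') auto
  qed
  moreover have "Z_spectrum \<inter> {t<..} \<subseteq> (\<Union>k\<in>T. ?constants k)"
    using Z_spectrum_imp_strip_constant[OF _ _ t(1)] by (fastforce simp: T_def)
  ultimately have "x islimpt (\<Union>k\<in>T. ?constants k)"
    by (rule islimpt_subset)
  moreover have "finite T"
    unfolding T_def by (rule finite_bounded_markoff_strips)
  ultimately obtain \<sigma> \<tau> c where strip: "markoff_strip \<sigma> \<tau> c"
    and limit: "x islimpt range (markoff_strip.strip_constant \<sigma> \<tau> c)"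
    unfolding islimpt_finite_union_iff[OF \<open>finite T\<close>] by (auto simp: T_def)
  then have "x = c / rho c"
    using sequence_unique_limpt[OF markoff_strip.strip_constant_tendsto] by blast
  then show ?thesis
    using strip by blast
qed

theorem theorem1:
  shows "(\<forall>m. markoff_number m \<longrightarrow>
            (2 * real m / (sqrt (9 * (real m)^2 - 4) + 3 * real m))
              islimpt (Z_spectrum \<inter> {1/3<..}))
       \<and> (\<forall>x. x islimpt Z_spectrum \<and> x > 1/3 \<longrightarrow>
            (\<exists>m. markoff_number m \<and> x = 2 * real m / (sqrt (9 * (real m)^2 - 4) + 3 * real m)))"
  unfolding limit_value_eq
proof (intro conjI allI impI)
  fix m assume "markoff_number m"
  then obtain x y where "markoff_triple x y m"
    by (rule markoff_numberE)
  then obtain \<sigma> \<tau> where "markoff_strip \<sigma> \<tau> (real m)"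
    using markoff_triple_imp_maximal_triple unfolding markoff_strip_def by blast
  then show "real m / rho (real m) islimpt Z_spectrum \<inter> {1/3<..}"
    by (rule markoff_strip.islimpt_Z_spectrum)
next
  fix x :: real assume "x islimpt Z_spectrum \<and> x > 1/3"
  then obtain \<sigma> \<tau> c where strip: "markoff_strip \<sigma> \<tau> c" and x: "x = c / rho c"
    using islimpt_Z_spectrum_imp by blast
  obtain i j m where "markoff_triple i j m" "c = real m"
    using markoff_strip.triple[OF strip] by (rule real_markoff_tripleE)
  then show "\<exists>m. markoff_number m \<and> x = real m / rho (real m)"
    using x unfolding markoff_number_def by blast
qed

end
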